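(* The normalized potential corresponding to constant mean curvature surfaces (with mean curvature $|H|>1$) in the hyperbolic space $\mathbb{H}^3$ is identical to the one corresponding to their Euclidean correspondents, i.e. to the constant mean curvature surfaces in $\mathbb{E}^3$ associated to them by the Lawson correspondence.
   Context: $\mathbb{H}^3$ is hyperbolic 3-space of sectional curvature $-1$ in $\mathbb{R}^{3,1}$. Surfaces are given by conformal immersions $f:D\to\mathbb{H}^3$ of an open simply connected domain $D\subset\mathbb{C}$ containing $0$, with unit normal $N$, metric $e^{2u}dz\,d\bar z$, Hopf differential $Q\,dz^2$, $Q=\langle f_{zz},N\rangle$, and constant mean curvature $H$, $\langle f_{z\bar z},N\rangle=\frac12He^{2u}$. Lawson correspondence: there is a bijective correspondence between the space of isometric immersions of constant mean curvature $c>0$ in $\mathbb{E}^3$ and the space of isometric immersions of constant mean curvature $\sqrt{c^2+1}$ in $\mathbb{H}^3$; through it, (non-minimal) CMC surfaces in $\mathbb{E}^3$ correspond to CMC surfaces with $|H|>1$ in $\mathbb{H}^3$. Loop groups. Let $\sigma_3=\mathrm{diag}(1,-1)$. $\Lambda\mathrm{SL}(2,\mathbb{C})$ is the group of loops $g:S^1\to\mathrm{SL}(2,\mathbb{C})$ with $g(-\theta)=\sigma_3g(\theta)\sigma_3^{-1}$ (in an $H^p$-topology, $p>\frac12$); $\Lambda\mathrm{SU}(2)$ is the subgroup of $\mathrm{SU}(2)$-valued loops; $\Lambda_+\mathrm{SL}(2,\mathbb{C})$ consists of loops extending holomorphically to the unit disk; $\Lambda_-^*\mathrm{SL}(2,\mathbb{C})$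 consists of loops extending holomorphically to the exterior of the unit disk and equal to $I$ at $\infty$. Normalized potential. For an extended frame $\tilde F(z,\theta)\in\Lambda\mathrm{SU}(2)$ of a harmonic map $\tilde N:D\to S^2=\mathrm{SU}(2)/\mathrm{U}(1)$ based at the identity, there is a discrete set $S\subset D\setminus\{0\}$ such that on $D\setminus S$ one has $\tilde F=\tilde F_-\tilde F_+$ with $\tilde F_-\in\Lambda_-^*\mathrm{SL}(2,\mathbb{C})$, $\tilde F_+\in\Lambda_+\mathrm{SL}(2,\mathbb{C})$; the normalized (meromorphic) potential is the meromorphic $(1,0)$-form $P=\theta\,\tilde F_-^{-1}d\tilde F_-$ on $D$, with poles in $S$. For a Euclidean CMC surface, the normalized potential is that of (an extended frame of) its harmonic Gauss map. For a hyperbolic CMC surface with $|H|>1$, it is that of its adjusted Gauss map, the harmonic map $\tilde N:D\to S^2$ which is the projection of the adjusted frame $\tilde F$, where $\tilde F^{-1}d\tilde F=\tilde\Omega$ is the adjusted Maurer–Cartan form $$\tilde\Omega=\begin{pmatrix}-\frac12u_z&-\theta^{-1}e^{-u}Q\\ \theta^{-1}\frac12e^u\sqrt{H^2-1}&\frac12u_z\end{pmatrix}dz+\begin{pmatrix}\frac12u_{\bar z}&-\theta\frac12e^u\sqrt{H^2-1}\\ \theta e^{-u}\overline Q&-\frac12u_{\bar z}\end{pmatrix}d\bar z .$$ *)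

theory Defs
  imports "HOL-Complex_Analysis.Complex_Analysis"
begin

section \<open>Smooth maps and Wirtinger derivatives\<close>

definition pd_x :: "(complex \<Rightarrow> 'a::real_normed_vector) \<Rightarrow> complex \<Rightarrow> 'a" where
  "pd_x f z = frechet_derivative f (at z) 1"

definition pd_y :: "(complex \<Rightarrow> 'a::real_normed_vector) \<Rightarrow> complex \<Rightarrow> 'a" where
  "pd_y f z = frechet_derivative f (at z) \<i>"

text \<open>Intended for open \<open>D\<close>, where \<open>differentiable_on\<close> is differentiability at each point of \<open>D\<close>.\<close>

primrec Ck_on :: "nat \<Rightarrow> complex set \<Rightarrow> (complex \<Rightarrow> 'a::real_normed_vector) \<Rightarrow> bool" where
  "Ck_on 0 D f \<longleftrightarrow> continuous_on D f"
| "Ck_on (Suc k) D f \<longleftrightarrow> f differentiable_on D \<and> Ck_on k D (pd_x f) \<and> Ck_on k D (pd_y f)"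

definition smooth_on :: "complex set \<Rightarrow> (complex \<Rightarrow> 'a::real_normed_vector) \<Rightarrow> bool" where
  "smooth_on D f \<longleftrightarrow> (\<forall>k. Ck_on k D f)"

definition pd_z :: "(complex \<Rightarrow> complex) \<Rightarrow> complex \<Rightarrow> complex" where
  "pd_z g z = (pd_x g z - \<i> * pd_y g z) / 2"

definition pd_zbar :: "(complex \<Rightarrow> complex) \<Rightarrow> complex \<Rightarrow> complex" where
  "pd_zbar g z = (pd_x g z + \<i> * pd_y g z) / 2"

definition vec_z :: "(complex \<Rightarrow> complex^'n) \<Rightarrow> complex \<Rightarrow> complex^'n" where
  "vec_z g z = (\<chi> i. pd_z (\<lambda>w. g w $ i) z)"

definition vec_zbar :: "(complex \<Rightarrow> complex^'n) \<Rightarrow> complex \<Rightarrow> complex^'n" where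
  "vec_zbar g z = (\<chi> i. pd_zbar (\<lambda>w. g w $ i) z)"

definition mat_z :: "(complex \<Rightarrow> complex^'n^'m) \<Rightarrow> complex \<Rightarrow> complex^'n^'m" where
  "mat_z g z = (\<chi> i j. pd_z (\<lambda>w. g w $ i $ j) z)"

definition mat_zbar :: "(complex \<Rightarrow> complex^'n^'m) \<Rightarrow> complex \<Rightarrow> complex^'n^'m" where
  "mat_zbar g z = (\<chi> i j. pd_zbar (\<lambda>w. g w $ i $ j) z)"


section \<open>Conformally immersed surfaces of constant mean curvature\<close>

definition cvec :: "real^'n \<Rightarrow> complex^'n" where
  "cvec v = (\<chi> i. complex_of_real (v $ i))"

text \<open>The complex bilinear extension of the diagonal form with entries \<open>\<epsilon>\<close>.\<close>

definition bform :: "real^'n \<Rightarrow> complex^'n \<Rightarrow> complex^'n \<Rightarrow> complex" where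
  "bform \<epsilon> v w = (\<Sum>i\<in>UNIV. complex_of_real (\<epsilon> $ i) * v $ i * w $ i)"

definition euclid_sig :: "real^3" where
  "euclid_sig = vector [1, 1, 1]"

definition lorentz_sig :: "real^4" where
  "lorentz_sig = vector [1, 1, 1, -1]"

definition hyp3 :: "(real^4) set" where
  "hyp3 = {x. bform lorentz_sig (cvec x) (cvec x) = -1 \<and> x $ 4 > 0}"

definition f_z :: "(complex \<Rightarrow> real^'n) \<Rightarrow> complex \<Rightarrow> complex^'n" where
  "f_z f = vec_z (\<lambda>w. cvec (f w))"

definition f_zbar :: "(complex \<Rightarrow> real^'n) \<Rightarrow> complex \<Rightarrow> complex^'n" where
  "f_zbar f = vec_zbar (\<lambda>w. cvec (f w))"

text \<open>The induced metric \<open>e\<^sup>2\<^sup>u dz dz'\<close> (with \<open>z'\<close> the conjugate of \<open>z\<close>) is \<open>e\<^sup>2\<^sup>u (dx\<^sup>2 + dy\<^sup>2)\<close>,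
  that is, \<open>\<langle>f_z, f_z\<rangle> = 0\<close> and \<open>\<langle>f_z, f_zbar\<rangle> = e\<^sup>2\<^sup>u / 2\<close>.\<close>

definition conformal_immersion ::
    "real^'n \<Rightarrow> complex set \<Rightarrow> (complex \<Rightarrow> real^'n) \<Rightarrow> (complex \<Rightarrow> real) \<Rightarrow> bool" where
  "conformal_immersion \<epsilon> D f u \<longleftrightarrow>
     smooth_on D f \<and> smooth_on D u \<and>
     (\<forall>z\<in>D. bform \<epsilon> (f_z f z) (f_z f z) = 0 \<and>
            bform \<epsilon> (f_z f z) (f_zbar f z) = complex_of_real (exp (2 * u z) / 2))"

definition unit_normal ::
    "real^'n \<Rightarrow> complex set \<Rightarrow> (complex \<Rightarrow> real^'n) \<Rightarrow> (complex \<Rightarrow> real^'n) \<Rightarrow> bool" where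
  "unit_normal \<epsilon> D f N \<longleftrightarrow>
     smooth_on D N \<and>
     (\<forall>z\<in>D. bform \<epsilon> (cvec (N z)) (cvec (N z)) = 1 \<and> bform \<epsilon> (cvec (N z)) (f_z f z) = 0)"

definition hopf ::
    "real^'n \<Rightarrow> (complex \<Rightarrow> real^'n) \<Rightarrow> (complex \<Rightarrow> real^'n) \<Rightarrow> complex \<Rightarrow> complex" where
  "hopf \<epsilon> f N z = bform \<epsilon> (vec_z (f_z f) z) (cvec (N z))"

definition const_mean_curvature ::
    "real^'n \<Rightarrow> complex set \<Rightarrow> (complex \<Rightarrow> real^'n) \<Rightarrow> (complex \<Rightarrow> real^'n) \<Rightarrow>
     (complex \<Rightarrow> real) \<Rightarrow> real \<Rightarrow> bool" where
  "const_mean_curvature \<epsilon> D f N u H \<longleftrightarrow>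
     (\<forall>z\<in>D. bform \<epsilon> (vec_zbar (f_z f) z) (cvec (N z)) = complex_of_real (H * exp (2 * u z) / 2))"

text \<open>In Euclidean space the unit normal is the one for which \<open>(f_x, f_y, N)\<close> is positively
  oriented, so that the adapted frame takes values in the rotation group.\<close>

definition cmc_E3 ::
    "complex set \<Rightarrow> (complex \<Rightarrow> real^3) \<Rightarrow> (complex \<Rightarrow> real^3) \<Rightarrow> (complex \<Rightarrow> real) \<Rightarrow> real \<Rightarrow> bool" where
  "cmc_E3 D f N u H \<longleftrightarrow>
     conformal_immersion euclid_sig D f u \<and> unit_normal euclid_sig D f N \<and>
     (\<forall>z\<in>D. cross3 (pd_x f z) (pd_y f z) \<bullet> N z > 0) \<and>
     const_mean_curvature euclid_sig D f N u H"

definition cmc_H3 ::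
    "complex set \<Rightarrow> (complex \<Rightarrow> real^4) \<Rightarrow> (complex \<Rightarrow> real^4) \<Rightarrow> (complex \<Rightarrow> real) \<Rightarrow> real \<Rightarrow> bool" where
  "cmc_H3 D f N u H \<longleftrightarrow>
     f ` D \<subseteq> hyp3 \<and>
     conformal_immersion lorentz_sig D f u \<and> unit_normal lorentz_sig D f N \<and>
     (\<forall>z\<in>D. bform lorentz_sig (cvec (N z)) (cvec (f z)) = 0) \<and>
     const_mean_curvature lorentz_sig D f N u H"

text \<open>For CMC immersions as above: Lawson correspondents are isometric and have the same trace-free second fundamental form,
  i.e. the same Hopf differential; the mean curvatures \<open>c > 0\<close> and \<open>H\<close> satisfy \<open>H\<^sup>2 = c\<^sup>2 + 1\<close>.
  Both signs of \<open>H\<close> are allowed.\<close>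

definition lawson_correspondents ::
    "complex set \<Rightarrow>
     (complex \<Rightarrow> real^3) \<Rightarrow> (complex \<Rightarrow> real^3) \<Rightarrow> (complex \<Rightarrow> real) \<Rightarrow> real \<Rightarrow>
     (complex \<Rightarrow> real^4) \<Rightarrow> (complex \<Rightarrow> real^4) \<Rightarrow> (complex \<Rightarrow> real) \<Rightarrow> real \<Rightarrow> bool" where
  "lawson_correspondents D f_E N_E u_E c f_H N_H u_H H \<longleftrightarrow>
     c > 0 \<and> \<bar>H\<bar> = sqrt (c\<^sup>2 + 1) \<and>
     (\<forall>z\<in>D. u_E z = u_H z \<and> hopf euclid_sig f_E N_E z = hopf lorentz_sig f_H N_H z)"


section \<open>Loop groups\<close>

definition cmat2 :: "complex \<Rightarrow> complex \<Rightarrow> complex \<Rightarrow> complex \<Rightarrow> complex^2^2" where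
  "cmat2 a b c d = vector [vector [a, b], vector [c, d]]"

definition sigma3 :: "complex^2^2" where
  "sigma3 = cmat2 1 0 0 (-1)"

definition SU2 :: "(complex^2^2) set" where
  "SU2 = {A. det A = 1 \<and> A ** (\<chi> i j. cnj (A $ j $ i)) = mat 1}"

abbreviation unit_circle :: "complex set" where
  "unit_circle \<equiv> sphere 0 1"

definition fourier_coeff :: "(complex \<Rightarrow> complex) \<Rightarrow> int \<Rightarrow> complex" where
  "fourier_coeff g k = integral {0..2*pi} (\<lambda>t. g (cis t) * cis (- of_int k * t)) / (2 * pi)"

text \<open>The Sobolev class \<open>H\<^sup>p\<close> on the circle. For \<open>p > 1/2\<close> its elements are continuous.\<close>

definition Hp_circle :: "real \<Rightarrow> (complex \<Rightarrow> complex) \<Rightarrow> bool" where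
  "Hp_circle p g \<longleftrightarrow> continuous_on unit_circle g \<and>
     (\<lambda>k::int. (1 + (of_int k)\<^sup>2) powr p * (cmod (fourier_coeff g k))\<^sup>2) summable_on UNIV"

text \<open>A loop is represented by a function on the whole plane; only its values on the unit circle
  matter.\<close>

definition Loop_SL2 :: "real \<Rightarrow> (complex \<Rightarrow> complex^2^2) set" where
  "Loop_SL2 p = {g. (\<forall>\<theta>\<in>unit_circle. det (g \<theta>) = 1 \<and>
                        g (- \<theta>) = sigma3 ** g \<theta> ** matrix_inv sigma3) \<and>
                    (\<forall>i j. Hp_circle p (\<lambda>\<theta>. g \<theta> $ i $ j))}"

definition Loop_SU2 :: "real \<Rightarrow> (complex \<Rightarrow> complex^2^2) set" where
  "Loop_SU2 p = {g \<in> Loop_SL2 p. \<forall>\<theta>\<in>unit_circle. g \<theta> \<in> SU2}"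

definition Loop_plus :: "real \<Rightarrow> (complex \<Rightarrow> complex^2^2) set" where
  "Loop_plus p = {g \<in> Loop_SL2 p. \<exists>G.
     (\<forall>\<theta>\<in>unit_circle. G \<theta> = g \<theta>) \<and>
     (\<forall>i j. continuous_on (cball 0 1) (\<lambda>\<theta>. G \<theta> $ i $ j) \<and>
            (\<lambda>\<theta>. G \<theta> $ i $ j) holomorphic_on ball 0 1)}"

definition Loop_minus_star :: "real \<Rightarrow> (complex \<Rightarrow> complex^2^2) set" where
  "Loop_minus_star p = {g \<in> Loop_SL2 p. \<exists>G.
     (\<forall>\<theta>\<in>unit_circle. G \<theta> = g \<theta>) \<and>
     (\<forall>i j. continuous_on (- ball 0 1) (\<lambda>\<theta>. G \<theta> $ i $ j) \<and>
            (\<lambda>\<theta>. G \<theta> $ i $ j) holomorphic_on (- cball 0 1)) \<and>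
     (G \<longlongrightarrow> mat 1) at_infinity}"


section \<open>Harmonic maps into the sphere, extended frames, normalized potentials\<close>

text \<open>The Lie algebra isomorphism of \<open>(\<real>\<^sup>3, \<times>)\<close> with \<open>su(2)\<close> given by
  \<open>x \<mapsto> \<i>/2 (x\<^sub>1 \<sigma>\<^sub>1 + x\<^sub>2 \<sigma>\<^sub>2 - x\<^sub>3 \<sigma>\<^sub>3)\<close>. With this choice, if \<open>F\<close> is an
  \<open>SU(2)\<close> lift of the adapted frame \<open>(e\<^sup>-\<^sup>u f_x, e\<^sup>-\<^sup>u f_y, N)\<close> of a conformal immersion
  into Euclidean space with data \<open>u, Q, H\<close>, then \<open>F\<^sup>-\<^sup>1 dF\<close> is the form \<open>MC_z dz + MC_zbar dz'\<close>
  below at \<open>\<theta> = 1\<close>, with \<open>h = H\<close>.\<close>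

definition su2_of :: "real^3 \<Rightarrow> complex^2^2" where
  "su2_of x = cmat2
     (- \<i> / 2 * of_real (x $ 3))                    (\<i> / 2 * (of_real (x $ 1) - \<i> * of_real (x $ 2)))
     (\<i> / 2 * (of_real (x $ 1) + \<i> * of_real (x $ 2)))  (\<i> / 2 * of_real (x $ 3))"

text \<open>The projection \<open>SU(2) \<rightarrow> SU(2)/U(1) = S\<^sup>2\<close>, written as a relation: \<open>A\<close> acts by conjugation
  on \<open>su(2) = \<real>\<^sup>3\<close> and takes the third unit vector to \<open>n\<close>.\<close>

definition projects_to :: "complex^2^2 \<Rightarrow> real^3 \<Rightarrow> bool" where
  "projects_to A n \<longleftrightarrow> su2_of n = A ** su2_of (axis 3 1) ** matrix_inv A"

text \<open>The harmonic map equation for the round sphere in a conformal coordinate.\<close>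

definition harmonic_S2 :: "complex set \<Rightarrow> (complex \<Rightarrow> real^3) \<Rightarrow> bool" where
  "harmonic_S2 D n \<longleftrightarrow>
     smooth_on D n \<and> (\<forall>z\<in>D. norm (n z) = 1) \<and>
     (\<forall>z\<in>D. vec_zbar (f_z n) z + bform euclid_sig (f_z n z) (f_zbar n z) *s cvec (n z) = 0)"

definition diagonal2 :: "complex^2^2 \<Rightarrow> bool" where
  "diagonal2 A \<longleftrightarrow> A $ 1 $ 2 = 0 \<and> A $ 2 $ 1 = 0"

definition offdiagonal2 :: "complex^2^2 \<Rightarrow> bool" where
  "offdiagonal2 A \<longleftrightarrow> A $ 1 $ 1 = 0 \<and> A $ 2 $ 2 = 0"

text \<open>Extended frames based at the identity. The diagonal and off-diagonal matrices are the
  \<open>\<pm>1\<close> eigenspaces of conjugation by \<open>\<sigma>\<^sub>3\<close>, so the last condition says that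
  \<open>F\<^sup>-\<^sup>1 dF = \<theta>\<^sup>-\<^sup>1 \<alpha>\<^sub>p' + \<alpha>\<^sub>k + \<theta> \<alpha>\<^sub>p''\<close>
  for the decomposition of \<open>\<alpha> = F\<^sup>-\<^sup>1 dF\<close> at \<open>\<theta> = 1\<close>.\<close>

definition extended_frame ::
    "real \<Rightarrow> complex set \<Rightarrow> (complex \<Rightarrow> real^3) \<Rightarrow> (complex \<Rightarrow> complex \<Rightarrow> complex^2^2) \<Rightarrow> bool" where
  "extended_frame p D n F \<longleftrightarrow>
     (\<forall>z\<in>D. F z \<in> Loop_SU2 p) \<and>
     (\<forall>\<theta>\<in>unit_circle. smooth_on D (\<lambda>z. F z \<theta>) \<and> F 0 \<theta> = mat 1) \<and>
     (\<forall>z\<in>D. projects_to (F z 1) (n z)) \<and>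
     (\<forall>z\<in>D. \<exists>A B A' B'. offdiagonal2 A \<and> offdiagonal2 A' \<and> diagonal2 B \<and> diagonal2 B' \<and>
        (\<forall>\<theta>\<in>unit_circle.
           matrix_inv (F z \<theta>) ** mat_z (\<lambda>w. F w \<theta>) z = mat (1 / \<theta>) ** A + B \<and>
           matrix_inv (F z \<theta>) ** mat_zbar (\<lambda>w. F w \<theta>) z = mat \<theta> ** A' + B'))"

text \<open>\<open>P\<close> stands for the coefficient of the meromorphic form \<open>P dz\<close>. It is normalized at its poles
  and removable singularities (\<open>nicely_meromorphic_on\<close>), which makes it unique as a function on \<open>D\<close>.
  Holomorphy of \<open>Fm\<close> in \<open>z\<close> expresses that \<open>\<theta> Fm\<^sup>-\<^sup>1 dFm\<close> is of type (1,0).\<close>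

definition normalized_potential ::
    "real \<Rightarrow> complex set \<Rightarrow> (complex \<Rightarrow> real^3) \<Rightarrow> (complex \<Rightarrow> complex^2^2) \<Rightarrow> bool" where
  "normalized_potential p D n P \<longleftrightarrow>
     harmonic_S2 D n \<and>
     (\<exists>F S Fm Fp.
        extended_frame p D n F \<and>
        S \<subseteq> D - {0} \<and> S sparse_in D \<and>
        (\<forall>z\<in>D - S. Fm z \<in> Loop_minus_star p \<and> Fp z \<in> Loop_plus p \<and>
                   (\<forall>\<theta>\<in>unit_circle. F z \<theta> = Fm z \<theta> ** Fp z \<theta>)) \<and>
        (\<forall>i j. (\<lambda>z. P z $ i $ j) nicely_meromorphic_on D \<and>
               (\<lambda>z. P z $ i $ j) holomorphic_on (D - S)) \<and>
        (\<forall>\<theta>\<in>unit_circle.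
           (\<forall>i j. (\<lambda>z. Fm z \<theta> $ i $ j) holomorphic_on (D - S)) \<and>
           (\<forall>z\<in>D - S. P z = mat \<theta> ** matrix_inv (Fm z \<theta>) ** mat_z (\<lambda>w. Fm w \<theta>) z)))"


section \<open>The Gauss maps\<close>

text \<open>The Gauss map of a Euclidean surface after the rotation that takes the adapted frame
  at \<open>0\<close> to the standard frame, so that the adapted frame is based at the identity.\<close>

definition based_gauss_map ::
    "(complex \<Rightarrow> real^3) \<Rightarrow> (complex \<Rightarrow> real^3) \<Rightarrow> complex \<Rightarrow> real^3" where
  "based_gauss_map f N z =
     vector [N z \<bullet> sgn (pd_x f 0), N z \<bullet> sgn (pd_y f 0), N z \<bullet> N 0]"

definition MC_z ::
    "(complex \<Rightarrow> real) \<Rightarrow> (complex \<Rightarrow> complex) \<Rightarrow> real \<Rightarrow> complex \<Rightarrow> complex \<Rightarrow> complex^2^2" where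
  "MC_z u Q h \<theta> z =
     (let u_z = pd_z (\<lambda>w. of_real (u w)) z in
      cmat2 (- u_z / 2)                             (- (1 / \<theta>) * of_real (exp (- u z)) * Q z)
            ((1 / \<theta>) * of_real (exp (u z) * h / 2))  (u_z / 2))"

definition MC_zbar ::
    "(complex \<Rightarrow> real) \<Rightarrow> (complex \<Rightarrow> complex) \<Rightarrow> real \<Rightarrow> complex \<Rightarrow> complex \<Rightarrow> complex^2^2" where
  "MC_zbar u Q h \<theta> z =
     (let u_zbar = pd_zbar (\<lambda>w. of_real (u w)) z in
      cmat2 (u_zbar / 2)                             (- \<theta> * of_real (exp (u z) * h / 2))
            (\<theta> * of_real (exp (- u z)) * cnj (Q z))  (- u_zbar / 2))"

definition adjusted_frame ::
    "real \<Rightarrow> complex set \<Rightarrow> (complex \<Rightarrow> real) \<Rightarrow> (complex \<Rightarrow> complex) \<Rightarrow> real \<Rightarrow>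
     (complex \<Rightarrow> complex \<Rightarrow> complex^2^2) \<Rightarrow> bool" where
  "adjusted_frame p D u Q H F \<longleftrightarrow>
     (\<forall>z\<in>D. F z \<in> Loop_SU2 p) \<and>
     (\<forall>\<theta>\<in>unit_circle. smooth_on D (\<lambda>z. F z \<theta>) \<and> F 0 \<theta> = mat 1) \<and>
     (\<forall>z\<in>D. \<forall>\<theta>\<in>unit_circle.
        matrix_inv (F z \<theta>) ** mat_z (\<lambda>w. F w \<theta>) z = MC_z u Q (sqrt (H\<^sup>2 - 1)) \<theta> z \<and>
        matrix_inv (F z \<theta>) ** mat_zbar (\<lambda>w. F w \<theta>) z = MC_zbar u Q (sqrt (H\<^sup>2 - 1)) \<theta> z)"

definition adjusted_gauss_map ::
    "real \<Rightarrow> complex set \<Rightarrow> (complex \<Rightarrow> real^4) \<Rightarrow> (complex \<Rightarrow> real^4) \<Rightarrow> (complex \<Rightarrow> real) \<Rightarrow> real \<Rightarrow>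
     (complex \<Rightarrow> real^3) \<Rightarrow> bool" where
  "adjusted_gauss_map p D f N u H n \<longleftrightarrow>
     (\<exists>F. adjusted_frame p D u (hopf lorentz_sig f N) H F \<and> (\<forall>z\<in>D. projects_to (F z 1) (n z)))"

end

theory Submission
  imports Defs
begin

text \<open>
  The Lawson correspondence keeps the metric \<open>u\<close> and the Hopf differential \<open>Q\<close>, and turns the
  mean curvature \<open>c\<close> into \<open>H\<close> with \<open>H\<^sup>2 - 1 = c\<^sup>2\<close>. The adjusted Maurer-Cartan form
  of the hyperbolic surface contains \<open>H\<close> only through \<open>sqrt (H\<^sup>2 - 1) = c\<close>, so at \<open>\<theta> = 1\<close> it is
  the Maurer-Cartan form of an \<open>SU(2)\<close> lift of the adapted frame of the Euclidean correspondent.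
  Solutions of such a linear system are determined by their value at \<open>0\<close>; hence the adjusted Gauss
  map is the Euclidean Gauss map in coordinates given by the adapted frame at \<open>0\<close>
  (\<open>adjusted_gauss_map_eq_based_gauss_map\<close>). In detail,
  \<open>frame_row\<close> encodes the rows of the Euclidean adapted frame as \<open>su(2)\<close>-valued functions, the
  Gauss-Weingarten equations become the Lax equation \<open>dY = [Y, \<alpha>]\<close>, and conjugation by the adjusted
  frame therefore makes these rows constant.

  Since the two Gauss maps agree on \<open>D\<close>, they have the same normalized potentials. It remains to
  see that a Gauss map has at most one (\<open>normalized_potential_unique\<close>). Two extended frames
  of the same map differ by right multiplication with a diagonal gauge that does not depend on
  \<open>\<theta>\<close> (\<open>extended_frame_unique_up_to_gauge\<close>). Such a gauge can be absorbed into the plus factor of the Birkhoff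
  factorization, whose minus factor is unique because a loop that extends holomorphically both
  inside and outside the circle, with a limit at infinity, is constant (\<open>birkhoff_minus_factor_unique\<close>). So the minus factors,
  and with them the potentials, agree away from a discrete set, and on that set the normalization at poles
  and removable singularities leaves no freedom.
\<close>

(* frees the dollar sign for vector components, where it is otherwise ambiguous *)
no_notation fps_nth (infixl "$" 75)

section \<open>Matrix algebra\<close>

lemma matrix_inv_det_1:
  fixes A :: "complex^'n^'n"
  assumes "det A = 1"
  shows "A ** matrix_inv A = mat 1" "matrix_inv A ** A = mat 1"
proof -
  have "invertible A"
    using assms by (simp add: invertible_det_nz)
  then have "\<exists>B. A ** B = mat 1 \<and> B ** A = mat 1"
    unfolding invertible_def .
  then show "A ** matrix_inv A = mat 1" "matrix_inv A ** A = mat 1"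
    unfolding matrix_inv_def by (metis (mono_tags, lifting) someI_ex)+
qed

text \<open>The inverse of a matrix of determinant \<open>1\<close> as a linear function of its entries. Inverses of
  differentiable or holomorphic families thus inherit regularity entry by entry.\<close>

definition adjugate2 :: "complex^2^2 \<Rightarrow> complex^2^2" where
  "adjugate2 A = cmat2 (A $ 2 $ 2) (- A $ 1 $ 2) (- A $ 2 $ 1) (A $ 1 $ 1)"

lemma adjugate2_mult:
  "adjugate2 A ** A = mat (det A)" "A ** adjugate2 A = mat (det A)"
  by (simp_all add: adjugate2_def cmat2_def vec_eq_iff forall_2 matrix_matrix_mult_def sum_2 mat_def det_2 algebra_simps)

lemma cmat2_nth:
  "cmat2 a b c d $ 1 $ 1 = a" "cmat2 a b c d $ 1 $ 2 = b"
  "cmat2 a b c d $ 2 $ 1 = c" "cmat2 a b c d $ 2 $ 2 = d"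
  by (simp_all add: cmat2_def)

lemma matrix_sub_ldistrib: "A ** (B - C) = A ** B - A ** (C :: 'a::ring_1^'n^'m)"
  by (simp add: matrix_matrix_mult_def vec_eq_iff algebra_simps sum_subtractf)

lemma matrix_sub_rdistrib: "(A - B) ** C = A ** C - B ** (C :: 'a::ring_1^'n^'m)"
  by (simp add: matrix_matrix_mult_def vec_eq_iff algebra_simps sum_subtractf)

lemma matrix_add_rdistrib: "(A + B) ** C = A ** C + B ** (C :: 'a::ring_1^'n^'m)"
  by (simp add: matrix_matrix_mult_def vec_eq_iff algebra_simps sum.distrib)

lemma matrix_minus_mult_left: "(- A) ** C = - (A ** (C :: 'a::ring_1^'n^'m))"
  by (simp add: matrix_matrix_mult_def vec_eq_iff sum_negf)

lemma matrix_minus_mult_right: "A ** (- C) = - (A ** (C :: 'a::ring_1^'n^'m))"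
  by (simp add: matrix_matrix_mult_def vec_eq_iff sum_negf)

lemma matrix_mul_mat_commute: "mat t ** A = A ** mat (t :: 'a::comm_ring_1)"
proof -
  have "(\<Sum>k\<in>UNIV. (if i = k then t else 0) * A $ k $ j) = t * A $ i $ j" for i j
    by (simp add: if_distrib[of "\<lambda>x. x * _"] cong: if_cong)
  moreover have "(\<Sum>k\<in>UNIV. A $ i $ k * (if k = j then t else 0)) = A $ i $ j * t" for i j
    by (simp add: if_distrib[of "(*) _"] cong: if_cong)
  ultimately show ?thesis
    by (simp add: matrix_matrix_mult_def mat_def vec_eq_iff mult.commute)
qed

lemmas matrix_ring_simps =
  matrix_add_ldistrib matrix_add_rdistrib matrix_sub_ldistrib matrix_sub_rdistrib
  matrix_minus_mult_left matrix_minus_mult_right matrix_mul_assoc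

lemma eq_mult_of_inv_mult_eq:
  fixes F M :: "complex^2^2"
  assumes "det F = 1" "matrix_inv F ** M = X"
  shows "M = F ** X"
  using assms(2) matrix_inv_det_1(1)[OF assms(1)] by (metis matrix_mul_assoc matrix_mul_lid)

section \<open>Partial derivatives of smooth maps\<close>

lemma frechet_derivative_cong:
  assumes "open D" "z \<in> D" "\<And>w. w \<in> D \<Longrightarrow> f w = g w"
  shows "frechet_derivative f (at z) = frechet_derivative g (at z)"
proof -
  have "(f has_derivative L) (at z) \<longleftrightarrow> (g has_derivative L) (at z)" for L
    using has_derivative_transform_within_open[OF _ assms(1,2)] assms(3) by metis
  then show ?thesis
    unfolding frechet_derivative_def by simp
qed

lemma Ck_on_cong:
  assumes "open D" "\<And>z. z \<in> D \<Longrightarrow> f z = g z"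
  shows "Ck_on k D f \<longleftrightarrow> Ck_on k D g"
  using assms(2)
proof (induction k arbitrary: f g)
  case 0
  then show ?case by (auto intro: continuous_on_cong)
next
  case (Suc k)
  have "f differentiable_on D \<longleftrightarrow> g differentiable_on D"
    using Suc.prems has_derivative_transform_within_open[OF _ assms(1)]
    unfolding differentiable_on_eq_differentiable_at[OF assms(1)] differentiable_def by metis
  moreover have "Ck_on k D (pd_x f) \<longleftrightarrow> Ck_on k D (pd_x g)" "Ck_on k D (pd_y f) \<longleftrightarrow> Ck_on k D (pd_y g)"
    unfolding pd_x_def pd_y_def
    using frechet_derivative_cong[OF assms(1) _ Suc.prems] by (auto intro!: Suc.IH)
  ultimately show ?case by simp
qed

lemma smooth_on_differentiable:
  assumes "smooth_on D f" "open D" "z \<in> D"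
  shows "f differentiable (at z)"
proof -
  have "Ck_on (Suc 0) D f"
    using assms(1) unfolding smooth_on_def by blast
  then show ?thesis
    using assms(2,3) by (simp add: differentiable_on_eq_differentiable_at)
qed

lemma smooth_on_pd:
  assumes "smooth_on D f"
  shows "smooth_on D (pd_x f)" "smooth_on D (pd_y f)"
  using assms unfolding smooth_on_def by (metis Ck_on.simps(2))+

lemma differentiable_component:
  fixes f :: "complex \<Rightarrow> 'b::real_normed_vector^'n"
  assumes "f differentiable (at z)"
  shows "(\<lambda>w. f w $ i) differentiable (at z)"
    and "pd_x (\<lambda>w. f w $ i) z = pd_x f z $ i"
    and "pd_y (\<lambda>w. f w $ i) z = pd_y f z $ i"
proof -
  have "(f has_derivative frechet_derivative f (at z)) (at z)"
    using assms frechet_derivative_works by blast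
  then have D: "((\<lambda>w. f w $ i) has_derivative (\<lambda>h. frechet_derivative f (at z) h $ i)) (at z)"
    by (rule bounded_linear.has_derivative[OF bounded_linear_vec_nth])
  show "(\<lambda>w. f w $ i) differentiable (at z)"
    using D differentiable_def by blast
  show "pd_x (\<lambda>w. f w $ i) z = pd_x f z $ i" "pd_y (\<lambda>w. f w $ i) z = pd_y f z $ i"
    unfolding pd_x_def pd_y_def using frechet_derivative_at[OF D] by metis+
qed

lemma Ck_on_component:
  fixes f :: "complex \<Rightarrow> 'b::real_normed_vector^'n"
  assumes "open D" "Ck_on k D f"
  shows "Ck_on k D (\<lambda>w. f w $ i)"
  using assms(2)
proof (induction k arbitrary: f)
  case 0
  then show ?case by (auto intro: continuous_on_component)
next
  case (Suc k)
  then have d: "f differentiable (at z)" if "z \<in> D" for z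
    using that by (simp add: differentiable_on_eq_differentiable_at assms(1))
  have "Ck_on k D (\<lambda>w. pd_x f w $ i)" "Ck_on k D (\<lambda>w. pd_y f w $ i)"
    using Suc by auto
  then have "Ck_on k D (pd_x (\<lambda>w. f w $ i))" "Ck_on k D (pd_y (\<lambda>w. f w $ i))"
    by (simp_all add: Ck_on_cong[OF assms(1) differentiable_component(2)[OF d]]
        Ck_on_cong[OF assms(1) differentiable_component(3)[OF d]])
  moreover have "(\<lambda>w. f w $ i) differentiable_on D"
    using differentiable_component(1)[OF d] by (simp add: differentiable_on_eq_differentiable_at assms(1))
  ultimately show ?case by simp
qed

lemma smooth_on_component:
  fixes f :: "complex \<Rightarrow> 'b::real_normed_vector^'n"
  shows "open D \<Longrightarrow> smooth_on D f \<Longrightarrow> smooth_on D (\<lambda>w. f w $ i)"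
  unfolding smooth_on_def using Ck_on_component by blast

lemma real_pd_x_DERIV:
  fixes g :: "complex \<Rightarrow> real"
  assumes "g differentiable (at (z + of_real t))"
  shows "((\<lambda>s. g (z + of_real s)) has_real_derivative pd_x g (z + of_real t)) (at t)"
proof -
  define L where "L = frechet_derivative g (at (z + of_real t))"
  have L: "(g has_derivative L) (at (z + of_real t))"
    unfolding L_def using assms frechet_derivative_works by blast
  then interpret linear L by (rule has_derivative_linear)
  have "((\<lambda>s. z + of_real s) has_derivative (\<lambda>s. of_real s)) (at t)"
    by (auto intro!: derivative_eq_intros)
  from diff_chain_at[OF this L] have "((\<lambda>s. g (z + of_real s)) has_derivative (\<lambda>s. L (of_real s))) (at t)"
    by (simp add: o_def)
  moreover have "(\<lambda>s. L (of_real s)) = (*) (pd_x g (z + of_real t))"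
  proof
    fix s show "L (of_real s) = pd_x g (z + of_real t) * s"
      using scaleR[of s 1] by (simp add: pd_x_def L_def scaleR_conv_of_real mult.commute)
  qed
  ultimately show ?thesis
    by (simp add: has_field_derivative_def)
qed

lemma real_pd_y_DERIV:
  fixes g :: "complex \<Rightarrow> real"
  assumes "g differentiable (at (z + \<i> * of_real t))"
  shows "((\<lambda>s. g (z + \<i> * of_real s)) has_real_derivative pd_y g (z + \<i> * of_real t)) (at t)"
proof -
  define L where "L = frechet_derivative g (at (z + \<i> * of_real t))"
  have L: "(g has_derivative L) (at (z + \<i> * of_real t))"
    unfolding L_def using assms frechet_derivative_works by blast
  then interpret linear L by (rule has_derivative_linear)
  have "((\<lambda>s. z + \<i> * of_real s) has_derivative (\<lambda>s. \<i> * of_real s)) (at t)"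
    by (auto intro!: derivative_eq_intros)
  from diff_chain_at[OF this L] have "((\<lambda>s. g (z + \<i> * of_real s)) has_derivative (\<lambda>s. L (\<i> * of_real s))) (at t)"
    by (simp add: o_def)
  moreover have "(\<lambda>s. L (\<i> * of_real s)) = (*) (pd_y g (z + \<i> * of_real t))"
  proof
    fix s show "L (\<i> * of_real s) = pd_y g (z + \<i> * of_real t) * s"
      using scaleR[of s \<i>] by (simp add: pd_y_def L_def scaleR_conv_of_real mult.commute)
  qed
  ultimately show ?thesis
    by (simp add: has_field_derivative_def)
qed

text \<open>Two applications of the mean value theorem, in either order, write the second difference of \<open>g\<close>
  over a small square as the area times a value of either mixed derivative; both derivatives are
  continuous at the corner.\<close>

lemma pd_commute:
  fixes g :: "complex \<Rightarrow> real"
  assumes g: "smooth_on D g" and D: "open D" "z \<in> D"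
  shows "pd_y (pd_x g) z = pd_x (pd_y g) z"
proof (rule ccontr)
  assume neq: "pd_y (pd_x g) z \<noteq> pd_x (pd_y g) z"
  define e where "e = dist (pd_y (pd_x g) z) (pd_x (pd_y g) z) / 2"
  have "e > 0"
    using neq by (simp add: e_def)
  have dg: "g differentiable (at w)" "pd_x g differentiable (at w)" "pd_y g differentiable (at w)"
    "pd_y (pd_x g) differentiable (at w)" "pd_x (pd_y g) differentiable (at w)" if "w \<in> D" for w
    using that g D smooth_on_differentiable smooth_on_pd by blast+
  obtain r where r: "r > 0" "ball z r \<subseteq> D"
    using D open_contains_ball by blast
  have "isCont (pd_y (pd_x g)) z" "isCont (pd_x (pd_y g)) z"
    using dg D differentiable_imp_continuous_within by blast+
  then obtain d1 d2 where d: "d1 > 0" "d2 > 0"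
    "\<And>w. dist w z < d1 \<Longrightarrow> dist (pd_y (pd_x g) w) (pd_y (pd_x g) z) < e"
    "\<And>w. dist w z < d2 \<Longrightarrow> dist (pd_x (pd_y g) w) (pd_x (pd_y g) z) < e"
    unfolding continuous_at_eps_delta using \<open>e > 0\<close> by metis
  define s where "s = min r (min d1 d2) / 3"
  have s: "s > 0" "3 * s \<le> r" "3 * s \<le> d1" "3 * s \<le> d2"
    using r d by (auto simp: s_def)
  have near: "dist (z + of_real x + \<i> * of_real y) z < 3 * s" if "0 \<le> x" "x \<le> s" "0 \<le> y" "y \<le> s" for x y
  proof -
    have "dist (z + of_real x + \<i> * of_real y) z = cmod (of_real x + \<i> * of_real y)"
      by (simp add: dist_norm)
    also have "\<dots> \<le> cmod (of_real x) + cmod (\<i> * of_real y)"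
      by (rule norm_triangle_ineq)
    finally show ?thesis
      using that s by (simp add: norm_mult)
  qed
  have inD: "z + of_real x + \<i> * of_real y \<in> D" if "0 \<le> x" "x \<le> s" "0 \<le> y" "y \<le> s" for x y
    using near[OF that] s r by (auto simp: dist_commute subset_iff)
  have inD': "z + \<i> * of_real y + of_real x \<in> D" if "0 \<le> x" "x \<le> s" "0 \<le> y" "y \<le> s" for x y
    using inD[OF that] by (simp add: add_ac)
  define \<Delta> where "\<Delta> = g (z + of_real s + \<i> * of_real s) - g (z + of_real s) - g (z + \<i> * of_real s) + g z"
  have "\<exists>x>0. x < s \<and> (g (z + \<i> * of_real s + of_real s) - g (z + of_real s))
        - (g (z + \<i> * of_real s + of_real 0) - g (z + of_real 0))
      = (s - 0) * (pd_x g (z + \<i> * of_real s + of_real x) - pd_x g (z + of_real x))"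
    using s inD'[of _ s] inD'[of _ 0]
    by (intro MVT2[of 0 s "\<lambda>x. g (z + \<i> * of_real s + of_real x) - g (z + of_real x)"])
       (auto intro!: DERIV_diff real_pd_x_DERIV dg)
  then obtain x where x: "0 < x" "x < s"
    "\<Delta> = s * (pd_x g (z + of_real x + \<i> * of_real s) - pd_x g (z + of_real x + \<i> * of_real 0))"
    by (auto simp: \<Delta>_def algebra_simps)
  have "\<exists>y>0. y < s \<and> pd_x g (z + of_real x + \<i> * of_real s) - pd_x g (z + of_real x + \<i> * of_real 0)
      = (s - 0) * pd_y (pd_x g) (z + of_real x + \<i> * of_real y)"
    using s x inD[of x] by (intro MVT2) (auto intro!: real_pd_y_DERIV dg)
  then obtain y where y: "0 < y" "y < s" "\<Delta> = s * (s * pd_y (pd_x g) (z + of_real x + \<i> * of_real y))"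
    using x(3) by auto
  have "\<exists>y>0. y < s \<and> (g (z + of_real s + \<i> * of_real s) - g (z + \<i> * of_real s))
        - (g (z + of_real s + \<i> * of_real 0) - g (z + \<i> * of_real 0))
      = (s - 0) * (pd_y g (z + of_real s + \<i> * of_real y) - pd_y g (z + \<i> * of_real y))"
    using s inD[of s] inD[of 0]
    by (intro MVT2[of 0 s "\<lambda>y. g (z + of_real s + \<i> * of_real y) - g (z + \<i> * of_real y)"])
       (auto intro!: DERIV_diff real_pd_y_DERIV dg)
  then obtain y' where y': "0 < y'" "y' < s"
    "\<Delta> = s * (pd_y g (z + \<i> * of_real y' + of_real s) - pd_y g (z + \<i> * of_real y' + of_real 0))"
    by (auto simp: \<Delta>_def algebra_simps)
  have "\<exists>x>0. x < s \<and> pd_y g (z + \<i> * of_real y' + of_real s) - pd_y g (z + \<i> * of_real y' + of_real 0)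
      = (s - 0) * pd_x (pd_y g) (z + \<i> * of_real y' + of_real x)"
    using s y' inD'[of _ y'] by (intro MVT2) (auto intro!: real_pd_x_DERIV dg)
  then obtain x' where x': "0 < x'" "x' < s" "\<Delta> = s * (s * pd_x (pd_y g) (z + of_real x' + \<i> * of_real y'))"
    using y'(3) by (auto simp: algebra_simps)
  have "pd_y (pd_x g) (z + of_real x + \<i> * of_real y) = pd_x (pd_y g) (z + of_real x' + \<i> * of_real y')"
    using y(3) x'(3) s(1) by simp
  moreover have "dist (pd_y (pd_x g) (z + of_real x + \<i> * of_real y)) (pd_y (pd_x g) z) < e"
    using near[of x y] x y s by (intro d) auto
  moreover have "dist (pd_x (pd_y g) (z + of_real x' + \<i> * of_real y')) (pd_x (pd_y g) z) < e"
    using near[of x' y'] x' y' s by (intro d) auto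
  ultimately show False
    unfolding e_def by (metis dist_triangle_half_r order_less_irrefl)
qed

section \<open>Wirtinger derivatives\<close>

text \<open>The real differential of \<open>g\<close> in the form \<open>a dz + b dz'\<close>, with \<open>z'\<close> the conjugate of \<open>z\<close>. As a
  relation it asserts differentiability together with the values of \<open>pd_z\<close> and \<open>pd_zbar\<close>, so that the
  product and chain rules carry no side conditions.\<close>

definition has_wirtinger :: "(complex \<Rightarrow> complex) \<Rightarrow> complex \<Rightarrow> complex \<Rightarrow> complex \<Rightarrow> bool" where
  "has_wirtinger g z a b \<longleftrightarrow> (g has_derivative (\<lambda>h. a * h + b * cnj h)) (at z)"

lemma has_wirtinger_pd:
  assumes "g differentiable (at z)"
  shows "has_wirtinger g z (pd_z g z) (pd_zbar g z)"
proof -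
  define D where "D = frechet_derivative g (at z)"
  have D: "(g has_derivative D) (at z)"
    unfolding D_def using assms frechet_derivative_works by blast
  then interpret linear D
    by (rule has_derivative_linear)
  have "D h = pd_z g z * h + pd_zbar g z * cnj h" for h
  proof -
    have "h = Re h *\<^sub>R 1 + Im h *\<^sub>R \<i>"
      by (simp add: complex_eq_iff)
    then have "D h = Re h *\<^sub>R D 1 + Im h *\<^sub>R D \<i>"
      by (metis add scaleR)
    also have "\<dots> = pd_z g z * h + pd_zbar g z * cnj h"
      unfolding pd_z_def pd_zbar_def pd_x_def pd_y_def D_def[symmetric]
      by (simp add: complex_eq_iff field_simps)
    finally show ?thesis .
  qed
  then show ?thesis
    using D unfolding has_wirtinger_def by presburger
qed

lemma has_wirtinger_unique:
  assumes "has_wirtinger g z a b" "has_wirtinger g z a' b'"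
  shows "a = a'" "b = b'"
proof -
  have eq: "(\<lambda>h. a * h + b * cnj h) = (\<lambda>h. a' * h + b' * cnj h)"
    using assms unfolding has_wirtinger_def by (rule has_derivative_unique)
  have 1: "a + b = a' + b'"
    using fun_cong[OF eq, of 1] by simp
  have "\<i> * (a - b) = \<i> * (a' - b')"
    using fun_cong[OF eq, of \<i>] by (simp add: algebra_simps)
  then have 2: "a - b = a' - b'"
    by simp
  from 1 2 have "2 * a = 2 * a'" "2 * b = 2 * b'"
    by algebra+
  then show "a = a'" "b = b'"
    by simp_all
qed

lemma has_wirtinger_const: "has_wirtinger (\<lambda>_. c) z 0 0"
  unfolding has_wirtinger_def by simp

lemma has_wirtinger_add:
  assumes "has_wirtinger f z a b" "has_wirtinger g z a' b'"
  shows "has_wirtinger (\<lambda>w. f w + g w) z (a + a') (b + b')"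
proof -
  have "(\<lambda>h. (a + a') * h + (b + b') * cnj h) = (\<lambda>h. (a * h + b * cnj h) + (a' * h + b' * cnj h))"
    by (simp add: algebra_simps)
  then show ?thesis
    using has_derivative_add[OF assms[unfolded has_wirtinger_def]]
    unfolding has_wirtinger_def by simp
qed

lemma has_wirtinger_mult:
  assumes "has_wirtinger f z a b" "has_wirtinger g z a' b'"
  shows "has_wirtinger (\<lambda>w. f w * g w) z (a * g z + f z * a') (b * g z + f z * b')"
proof -
  have "(\<lambda>h. (a * g z + f z * a') * h + (b * g z + f z * b') * cnj h) =
        (\<lambda>h. f z * (a' * h + b' * cnj h) + (a * h + b * cnj h) * g z)"
    by (simp add: algebra_simps)
  then show ?thesis
    using has_derivative_mult[OF assms[unfolded has_wirtinger_def]]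
    unfolding has_wirtinger_def by simp
qed

lemma has_wirtinger_cmult:
  "has_wirtinger f z a b \<Longrightarrow> has_wirtinger (\<lambda>w. c * f w) z (c * a) (c * b)"
  using has_wirtinger_mult[OF has_wirtinger_const, of f z a b c] by simp

lemma has_wirtinger_cnj:
  assumes "has_wirtinger f z a b"
  shows "has_wirtinger (\<lambda>w. cnj (f w)) z (cnj b) (cnj a)"
proof -
  have "(\<lambda>h. cnj b * h + cnj a * cnj h) = (\<lambda>h. cnj (a * h + b * cnj h))"
    by (simp add: algebra_simps)
  then show ?thesis
    using has_derivative_cnj[OF assms[unfolded has_wirtinger_def]]
    unfolding has_wirtinger_def by simp
qed

lemma has_wirtinger_exp:
  assumes "has_wirtinger f z a b"
  shows "has_wirtinger (\<lambda>w. exp (f w)) z (exp (f z) * a) (exp (f z) * b)"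
proof -
  have "(exp has_derivative (*) (exp (f z))) (at (f z))"
    using DERIV_exp[of "f z"] by (simp add: has_field_derivative_def)
  then have "(exp \<circ> f has_derivative (*) (exp (f z)) \<circ> (\<lambda>h. a * h + b * cnj h)) (at z)"
    using assms unfolding has_wirtinger_def by (intro diff_chain_at)
  moreover have "(*) (exp (f z)) \<circ> (\<lambda>h. a * h + b * cnj h)
      = (\<lambda>h. (exp (f z) * a) * h + (exp (f z) * b) * cnj h)"
    by (rule ext) (simp add: algebra_simps)
  ultimately show ?thesis
    unfolding has_wirtinger_def o_def by simp
qed

lemma has_wirtinger_sum:
  assumes "finite I" "\<And>i. i \<in> I \<Longrightarrow> has_wirtinger (f i) z (a i) (b i)"
  shows "has_wirtinger (\<lambda>w. \<Sum>i\<in>I. f i w) z (\<Sum>i\<in>I. a i) (\<Sum>i\<in>I. b i)"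
  using assms by (induction I rule: finite_induct) (auto simp: has_wirtinger_const has_wirtinger_add)

lemma has_wirtinger_transform:
  assumes "has_wirtinger f z a b" "open D" "z \<in> D" "\<And>w. w \<in> D \<Longrightarrow> f w = g w"
  shows "has_wirtinger g z a b"
  using assms unfolding has_wirtinger_def
  by (blast intro: has_derivative_transform_within_open)

text \<open>This extracts the differential consequences of an algebraic identity that holds on all of \<open>D\<close>.\<close>

lemma has_wirtinger_constant_on:
  assumes "has_wirtinger f z a b" "open D" "z \<in> D" "\<And>w. w \<in> D \<Longrightarrow> f w = c"
  shows "a = 0" "b = 0"
  using has_wirtinger_unique[OF assms(1) has_wirtinger_transform[OF has_wirtinger_const assms(2,3)]]
    assms(4) by metis+

lemma has_wirtinger_zero_constant:
  assumes "open D" "connected D" "\<And>z. z \<in> D \<Longrightarrow> has_wirtinger f z 0 0" "z \<in> D" "w \<in> D"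
  shows "f z = f w"
  by (rule has_derivative_zero_unique_connected[OF assms(1,2) _ assms(4,5)])
     (use assms(3) in \<open>simp add: has_wirtinger_def\<close>)

lemma pd_of_real:
  fixes g :: "complex \<Rightarrow> real"
  assumes "g differentiable (at z)"
  shows "(\<lambda>w. complex_of_real (g w)) differentiable (at z)"
    and "pd_z (\<lambda>w. complex_of_real (g w)) z = (of_real (pd_x g z) - \<i> * of_real (pd_y g z)) / 2"
proof -
  have "(g has_derivative frechet_derivative g (at z)) (at z)"
    using assms frechet_derivative_works by blast
  then have D: "((\<lambda>w. complex_of_real (g w)) has_derivative (\<lambda>h. complex_of_real (frechet_derivative g (at z) h))) (at z)"
    by (rule has_derivative_of_real)
  show "(\<lambda>w. complex_of_real (g w)) differentiable (at z)"
    using D differentiable_def by blast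
  show "pd_z (\<lambda>w. complex_of_real (g w)) z = (of_real (pd_x g z) - \<i> * of_real (pd_y g z)) / 2"
    unfolding pd_z_def pd_x_def pd_y_def frechet_derivative_at[OF D, symmetric] ..
qed

lemma has_wirtinger_of_real:
  fixes g :: "complex \<Rightarrow> real"
  assumes "g differentiable (at z)"
  shows "has_wirtinger (\<lambda>w. of_real (g w)) z
           (pd_z (\<lambda>w. of_real (g w)) z) (cnj (pd_z (\<lambda>w. of_real (g w)) z))"
    and "pd_zbar (\<lambda>w. complex_of_real (g w)) z = cnj (pd_z (\<lambda>w. of_real (g w)) z)"
proof -
  have D: "has_wirtinger (\<lambda>w. of_real (g w)) z
           (pd_z (\<lambda>w. of_real (g w)) z) (pd_zbar (\<lambda>w. of_real (g w)) z)"
    using has_wirtinger_pd pd_of_real(1)[OF assms] by blast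
  show *: "pd_zbar (\<lambda>w. complex_of_real (g w)) z = cnj (pd_z (\<lambda>w. of_real (g w)) z)"
    using has_wirtinger_unique(2)[OF D] has_wirtinger_cnj[OF D] by simp
  show "has_wirtinger (\<lambda>w. of_real (g w)) z
           (pd_z (\<lambda>w. of_real (g w)) z) (cnj (pd_z (\<lambda>w. of_real (g w)) z))"
    using D * by simp
qed

text \<open>The mixed second derivative is a quarter of the Laplacian of \<open>g\<close>, hence real; this is the
  symmetry of second derivatives in complex form.\<close>

lemma has_wirtinger_pd_z_of_real:
  fixes g :: "complex \<Rightarrow> real"
  assumes g: "smooth_on D g" and D: "open D" "z \<in> D"
  defines "G \<equiv> \<lambda>w. complex_of_real (g w)"
  shows "has_wirtinger (pd_z G) z (pd_z (pd_z G) z) (pd_zbar (pd_z G) z)"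
    and "cnj (pd_zbar (pd_z G) z) = pd_zbar (pd_z G) z"
proof -
  note d = smooth_on_differentiable[OF _ D(1)]
  have G: "pd_z G w = 1 / 2 * of_real (pd_x g w) + (- \<i> / 2) * of_real (pd_y g w)" if "w \<in> D" for w
    using pd_of_real(2)[OF d[OF g that]] by (simp add: G_def field_simps)
  note X = has_wirtinger_of_real(1)[OF d[OF smooth_on_pd(1)[OF g] D(2)]]
  note Y = has_wirtinger_of_real(1)[OF d[OF smooth_on_pd(2)[OF g] D(2)]]
  have W: "has_wirtinger (pd_z G) z
      (1 / 2 * pd_z (\<lambda>w. of_real (pd_x g w)) z + (- \<i> / 2) * pd_z (\<lambda>w. of_real (pd_y g w)) z)
      (1 / 2 * cnj (pd_z (\<lambda>w. of_real (pd_x g w)) z) + (- \<i> / 2) * cnj (pd_z (\<lambda>w. of_real (pd_y g w)) z))"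
    (is "has_wirtinger _ _ ?a ?b")
    by (rule has_wirtinger_transform[OF has_wirtinger_add[OF has_wirtinger_cmult[OF X] has_wirtinger_cmult[OF Y]] D])
       (simp add: G)
  then have "(pd_z G) differentiable (at z)"
    unfolding has_wirtinger_def differentiable_def by blast
  then show W': "has_wirtinger (pd_z G) z (pd_z (pd_z G) z) (pd_zbar (pd_z G) z)"
    by (rule has_wirtinger_pd)
  have "cnj ?b = ?b"
    using pd_commute[OF g D] pd_of_real(2)[OF d[OF smooth_on_pd(1)[OF g] D(2)]]
      pd_of_real(2)[OF d[OF smooth_on_pd(2)[OF g] D(2)]]
    by (simp add: complex_eq_iff)
  then show "cnj (pd_zbar (pd_z G) z) = pd_zbar (pd_z G) z"
    unfolding has_wirtinger_unique(2)[OF W W'] .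
qed

section \<open>Matrix-valued maps and gauge transformations\<close>

definition has_mat_wirtinger ::
    "(complex \<Rightarrow> complex^'n^'m) \<Rightarrow> complex \<Rightarrow> complex^'n^'m \<Rightarrow> complex^'n^'m \<Rightarrow> bool" where
  "has_mat_wirtinger M z A B \<longleftrightarrow> (\<forall>i j. has_wirtinger (\<lambda>w. M w $ i $ j) z (A $ i $ j) (B $ i $ j))"

lemma has_mat_wirtinger_const: "has_mat_wirtinger (\<lambda>_. C) z 0 0"
  by (simp add: has_mat_wirtinger_def has_wirtinger_const)

lemma has_mat_wirtinger_unique:
  assumes "has_mat_wirtinger M z A B" "has_mat_wirtinger M z A' B'"
  shows "A = A'" "B = B'"
  using assms has_wirtinger_unique unfolding has_mat_wirtinger_def vec_eq_iff by blast+

lemma has_mat_wirtinger_mult: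
  assumes "has_mat_wirtinger M z A B" "has_mat_wirtinger N z A' B'"
  shows "has_mat_wirtinger (\<lambda>w. M w ** N w) z (A ** N z + M z ** A') (B ** N z + M z ** B')"
  unfolding has_mat_wirtinger_def
proof (intro allI)
  fix i j
  have "has_wirtinger (\<lambda>w. \<Sum>k\<in>UNIV. M w $ i $ k * N w $ k $ j) z
      (\<Sum>k\<in>UNIV. A $ i $ k * N z $ k $ j + M z $ i $ k * A' $ k $ j)
      (\<Sum>k\<in>UNIV. B $ i $ k * N z $ k $ j + M z $ i $ k * B' $ k $ j)"
    using assms unfolding has_mat_wirtinger_def
    by (intro has_wirtinger_sum has_wirtinger_mult) auto
  then show "has_wirtinger (\<lambda>w. (M w ** N w) $ i $ j) z
      ((A ** N z + M z ** A') $ i $ j) ((B ** N z + M z ** B') $ i $ j)"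
    by (simp add: matrix_matrix_mult_def sum.distrib)
qed

lemma has_mat_wirtinger_transform:
  assumes "has_mat_wirtinger M z A B" "open D" "z \<in> D" "\<And>w. w \<in> D \<Longrightarrow> M w = N w"
  shows "has_mat_wirtinger N z A B"
  unfolding has_mat_wirtinger_def
proof (intro allI)
  fix i j
  show "has_wirtinger (\<lambda>w. N w $ i $ j) z (A $ i $ j) (B $ i $ j)"
    by (rule has_wirtinger_transform[OF _ assms(2,3), of "\<lambda>w. M w $ i $ j"])
       (use assms in \<open>auto simp: has_mat_wirtinger_def\<close>)
qed

lemma has_mat_wirtinger_zero_constant:
  assumes "open D" "connected D" "\<And>z. z \<in> D \<Longrightarrow> has_mat_wirtinger M z 0 0" "z \<in> D" "w \<in> D"
  shows "M z = M w"
proof -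
  have "M z $ i $ j = M w $ i $ j" for i j
    by (rule has_wirtinger_zero_constant[OF assms(1,2) _ assms(4,5)])
       (use assms(3) in \<open>auto simp: has_mat_wirtinger_def\<close>)
  then show ?thesis
    by (simp add: vec_eq_iff)
qed

lemma smooth_on_mat_wirtinger:
  assumes "smooth_on D M" "open D" "z \<in> D"
  shows "has_mat_wirtinger M z (mat_z M z) (mat_zbar M z)"
  unfolding has_mat_wirtinger_def mat_z_def mat_zbar_def
  by (auto intro!: has_wirtinger_pd differentiable_component smooth_on_differentiable[OF assms])

text \<open>Differentiability comes from the adjugate, and the value from differentiating \<open>M\<^sup>-\<^sup>1 M = I\<close>.\<close>

lemma has_mat_wirtinger_inverse:
  fixes M :: "complex \<Rightarrow> complex^2^2"
  assumes M: "has_mat_wirtinger M z A B" and D: "open D" "z \<in> D"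
    and det: "\<And>w. w \<in> D \<Longrightarrow> det (M w) = 1"
  shows "has_mat_wirtinger (\<lambda>w. matrix_inv (M w)) z
           (- (matrix_inv (M z) ** A ** matrix_inv (M z)))
           (- (matrix_inv (M z) ** B ** matrix_inv (M z)))"
proof -
  have inv: "M w ** matrix_inv (M w) = mat 1" "matrix_inv (M w) ** M w = mat 1" if "w \<in> D" for w
    by (simp_all add: det[OF that] matrix_inv_det_1)
  have adj: "adjugate2 (M w) = matrix_inv (M w)" if "w \<in> D" for w
  proof -
    have "adjugate2 (M w) ** M w ** matrix_inv (M w) = matrix_inv (M w)"
      by (simp add: adjugate2_mult det[OF that])
    then show ?thesis
      by (simp add: matrix_mul_assoc[symmetric] inv[OF that])
  qed
  have "has_mat_wirtinger (\<lambda>w. adjugate2 (M w)) z (adjugate2 A) (adjugate2 B)"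
    using M has_wirtinger_cmult[of "\<lambda>w. M w $ _ $ _" z _ _ "-1"]
    unfolding has_mat_wirtinger_def by (simp add: adjugate2_def cmat2_def forall_2)
  then have I: "has_mat_wirtinger (\<lambda>w. matrix_inv (M w)) z (adjugate2 A) (adjugate2 B)"
    by (rule has_mat_wirtinger_transform[OF _ D]) (rule adj)
  have *: "has_mat_wirtinger (\<lambda>w. matrix_inv (M w) ** M w) z 0 0"
    by (rule has_mat_wirtinger_transform[OF has_mat_wirtinger_const D]) (simp add: inv)
  have "X = - (matrix_inv (M z) ** Y ** matrix_inv (M z))"
    if "X ** M z + matrix_inv (M z) ** Y = 0" for X Y
  proof -
    have "X ** M z = - (matrix_inv (M z) ** Y)"
      using that by (simp add: eq_neg_iff_add_eq_0)
    then have "X ** M z ** matrix_inv (M z) = - (matrix_inv (M z) ** Y) ** matrix_inv (M z)"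
      by simp
    then show ?thesis
      by (simp add: matrix_minus_mult_left matrix_mul_assoc[symmetric] inv[OF D(2)])
  qed
  then have "adjugate2 A = - (matrix_inv (M z) ** A ** matrix_inv (M z))"
    "adjugate2 B = - (matrix_inv (M z) ** B ** matrix_inv (M z))"
    using has_mat_wirtinger_unique[OF has_mat_wirtinger_mult[OF I M] *] by blast+
  then show ?thesis
    using I by simp
qed

text \<open>The form in which linear systems are compared below: if \<open>dF = F \<alpha>\<close> and \<open>dF' = F' \<alpha>'\<close>, then
  \<open>F K F'\<^sup>-\<^sup>1\<close> is constant as soon as \<open>dK = K \<alpha>' - \<alpha> K\<close>. For \<open>F' = F\<close> this is the Lax equation.\<close>

lemma has_mat_wirtinger_gauge:
  fixes F F' K :: "complex \<Rightarrow> complex^2^2"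
  assumes F: "has_mat_wirtinger F z (F z ** A) (F z ** B)"
    and K: "has_mat_wirtinger K z A0 B0"
    and F': "has_mat_wirtinger F' z (F' z ** A') (F' z ** B')"
    and D: "open D" "z \<in> D" "\<And>w. w \<in> D \<Longrightarrow> det (F' w) = 1"
  shows "has_mat_wirtinger (\<lambda>w. F w ** K w ** matrix_inv (F' w)) z
           (F z ** (A ** K z + A0 - K z ** A') ** matrix_inv (F' z))
           (F z ** (B ** K z + B0 - K z ** B') ** matrix_inv (F' z))"
proof -
  have inv: "X ** matrix_inv (F' z) ** F' z = X" for X
    using matrix_inv_det_1(2)[OF D(3)[OF D(2)]] by (simp add: matrix_mul_assoc[symmetric])
  show ?thesis
    using has_mat_wirtinger_mult[OF has_mat_wirtinger_mult[OF F K] has_mat_wirtinger_inverse[OF F' D]]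
    by (simp add: inv matrix_ring_simps)
qed

lemma has_mat_wirtinger_transition:
  fixes F F' :: "complex \<Rightarrow> complex^2^2"
  assumes F: "has_mat_wirtinger F z (F z ** A) (F z ** B)"
    and F': "has_mat_wirtinger F' z (F' z ** A') (F' z ** B')"
    and D: "open D" "z \<in> D" "\<And>w. w \<in> D \<Longrightarrow> det (F w) = 1"
  defines "K \<equiv> \<lambda>w. matrix_inv (F w) ** F' w"
  shows "has_mat_wirtinger K z (K z ** A' - A ** K z) (K z ** B' - B ** K z)"
proof -
  note inv = matrix_inv_det_1(2)[OF D(3)[OF D(2)]]
  show ?thesis
    unfolding K_def using has_mat_wirtinger_mult[OF has_mat_wirtinger_inverse[OF F D] F']
    by (simp add: inv matrix_ring_simps)
qed

section \<open>Uniqueness in the Birkhoff factorization\<close>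

text \<open>The maximum principle for the harmonic function \<open>Re f\<close> and its negative gives \<open>Re f = 0\<close>
  throughout, which a nonconstant \<open>f\<close>, being an open map, cannot satisfy.\<close>

lemma imaginary_boundary_imp_constant:
  assumes "f holomorphic_on ball 0 1" "continuous_on (cball 0 1) f"
    and "\<And>\<theta>. \<theta> \<in> sphere 0 1 \<Longrightarrow> Re (f \<theta>) = 0"
    and "w \<in> cball 0 1"
  shows "f w = f 0"
proof -
  have upper: "Re (g v) \<le> 0"
    if "g holomorphic_on ball 0 1" "continuous_on (cball 0 1) g"
      "\<And>\<theta>. \<theta> \<in> sphere 0 1 \<Longrightarrow> Re (g \<theta>) = 0" "v \<in> cball 0 1" for g v
    using maximum_real_frontier[of g "cball 0 1" 0 v] that by simp
  have Re0: "Re (f v) = 0" if "v \<in> cball 0 1" for v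
    using upper[of f v] upper[of "\<lambda>v. - f v" v] assms that
    by (fastforce intro: holomorphic_on_minus continuous_on_minus)
  have "f constant_on ball 0 1"
  proof (rule ccontr)
    assume "\<not> f constant_on ball 0 1"
    then have "open (f ` ball 0 1)"
      using open_mapping_thm[OF assms(1), of "ball 0 1"] by (simp add: constant_on_def)
    then obtain e where "e > 0" "ball (f 0) e \<subseteq> f ` ball 0 1"
      by (meson centre_in_ball imageI openE zero_less_one)
    then have "f 0 + of_real (e / 2) \<in> f ` ball 0 1"
      by (auto simp: subset_iff dist_norm)
    then show False
      using Re0[of 0] Re0 \<open>e > 0\<close> by (auto simp: complex_eq_iff)
  qed
  then have "f constant_on closure (ball 0 1)"
    by (rule constant_on_closureI) (use assms(2) in simp)
  then show ?thesis
    using assms(4) unfolding constant_on_def by (metis centre_in_cball closure_ball zero_less_one zero_le_one)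
qed

text \<open>Liouville's theorem for a function that is only known to be continuous across the circle.
  Reflection moves both functions into the disc: \<open>\<gamma>(w) = cnj (b (1 / cnj w))\<close> is holomorphic in the disc, and on
  the circle \<open>a\<close> is its complex conjugate. Hence \<open>a - \<gamma>\<close> is imaginary and \<open>a + \<gamma>\<close> real on
  the circle, so both are constant.\<close>

lemma holomorphic_inside_outside_eq_limit:
  fixes a b :: "complex \<Rightarrow> complex"
  assumes a: "continuous_on (cball 0 1) a" "a holomorphic_on ball 0 1"
    and b: "continuous_on (- ball 0 1) b" "b holomorphic_on (- cball 0 1)"
    and lim: "(b \<longlongrightarrow> l) at_infinity"
    and eq: "\<And>\<theta>. \<theta> \<in> sphere 0 1 \<Longrightarrow> a \<theta> = b \<theta>"
    and \<theta>: "\<theta> \<in> sphere 0 1"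
  shows "b \<theta> = l"
proof -
  define \<beta> where "\<beta> w = (if w = 0 then l else b (inverse w))" for w
  have out: "inverse w \<notin> ball 0 1" if "w \<in> cball 0 1 - {0}" for w :: complex
    using that by (auto simp: norm_inverse one_le_inverse_iff not_less simp flip: inverse_eq_divide)
  have out': "inverse w \<notin> cball 0 1" if "w \<in> ball 0 1 - {0}" for w :: complex
    using that by (auto simp: norm_inverse one_le_inverse_iff one_less_inverse_iff not_le simp flip: inverse_eq_divide)
  have lim0: "(\<beta> \<longlongrightarrow> \<beta> 0) (at 0)"
  proof -
    have "((\<lambda>w. b (inverse w)) \<longlongrightarrow> l) (at 0)"
      using lim by (simp add: lim_at_infinity_0 o_def)
    then have "(\<beta> \<longlongrightarrow> l) (at 0)"
      by (rule Lim_transform_eventually) (auto simp: \<beta>_def eventually_at_filter)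
    then show ?thesis
      by (simp add: \<beta>_def)
  qed
  have "continuous_on (cball 0 1 - {0}) (\<lambda>w. b (inverse w))"
    by (rule continuous_on_compose2[OF b(1)]) (use out in \<open>auto intro!: continuous_intros\<close>)
  then have "continuous_on (cball 0 1 - {0}) \<beta>"
    by (rule continuous_on_eq) (auto simp: \<beta>_def)
  then have cont: "continuous_on (cball 0 1) \<beta>"
    unfolding continuous_on_eq_continuous_within
  proof (intro ballI)
    fix w :: complex assume c: "\<forall>x\<in>cball 0 1 - {0}. continuous (at x within cball 0 1 - {0}) \<beta>"
      and w: "w \<in> cball 0 1"
    show "continuous (at w within cball 0 1) \<beta>"
    proof (cases "w = 0")
      case True
      then show ?thesis
        using lim0 by (simp add: continuous_within Lim_at_imp_Lim_at_within)
    next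
      case False
      have "at w within cball 0 1 - {0} = at w within cball 0 1"
        by (rule at_within_nhd[of _ "- {0}"]) (use False in auto)
      then show ?thesis
        using c w False by (metis Diff_iff empty_iff insert_iff)
    qed
  qed
  have "(\<lambda>w. b (inverse w)) holomorphic_on (ball 0 1 - {0})"
    using holomorphic_on_compose_gen[OF _ b(2), of inverse "ball 0 1 - {0}"] out'
    by (force simp: o_def intro!: holomorphic_intros)
  then have "\<beta> holomorphic_on (ball 0 1 - {0})"
    by (rule holomorphic_transform) (auto simp: \<beta>_def)
  then have hol: "\<beta> holomorphic_on ball 0 1"
    by (rule no_isolated_singularity[OF continuous_on_subset[OF cont ball_subset_cball]]) auto
  define \<gamma> where "\<gamma> = cnj \<circ> \<beta> \<circ> cnj"
  have hol\<gamma>: "\<gamma> holomorphic_on ball 0 1"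
  proof -
    have "cnj ` ball 0 1 = ball 0 1"
      by (auto simp: image_cnj_conv_vimage_cnj)
    then show ?thesis
      unfolding \<gamma>_def by (intro holomorphic_on_compose_cnj_cnj) (simp_all add: hol)
  qed
  have cont\<gamma>: "continuous_on (cball 0 1) \<gamma>"
    unfolding \<gamma>_def o_def
    by (intro continuous_intros continuous_on_compose2[OF cont]) auto
  have bdry: "a w = cnj (\<gamma> w)" if "w \<in> sphere 0 1" for w
  proof -
    have "w * cnj w = 1"
      using that complex_norm_square[of w] by simp
    then have "inverse (cnj w) = w"
      by (metis inverse_unique mult.commute)
    then show ?thesis
      using that eq by (auto simp: \<gamma>_def \<beta>_def)
  qed
  have 1: "a w - \<gamma> w = a 0 - \<gamma> 0" if "w \<in> cball 0 1" for w
    by (rule imaginary_boundary_imp_constant[of "\<lambda>w. a w - \<gamma> w"])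
       (use a hol\<gamma> cont\<gamma> bdry that in \<open>auto intro!: holomorphic_intros continuous_intros\<close>)
  have 2: "\<i> * (a w + \<gamma> w) = \<i> * (a 0 + \<gamma> 0)" if "w \<in> cball 0 1" for w
    by (rule imaginary_boundary_imp_constant[of "\<lambda>w. \<i> * (a w + \<gamma> w)"])
       (use a hol\<gamma> cont\<gamma> bdry that in \<open>auto intro!: holomorphic_intros continuous_intros\<close>)
  have const: "\<gamma> w = \<gamma> 0" if "w \<in> cball 0 1" for w
  proof -
    have "a w + \<gamma> w = a 0 + \<gamma> 0"
      using 2[OF that] by simp
    then have "(a w + \<gamma> w) - (a w - \<gamma> w) = (a 0 + \<gamma> 0) - (a 0 - \<gamma> 0)"
      by (simp only: 1[OF that])
    then show ?thesis by simp
  qed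
  have "b \<theta> = cnj (\<gamma> \<theta>)"
    using \<theta> eq bdry by metis
  also have "\<dots> = cnj (\<gamma> 0)"
    using const[of \<theta>] \<theta> by (auto dest: arg_cong[of _ _ cnj])
  also have "\<dots> = l"
    by (simp add: \<gamma>_def \<beta>_def)
  finally show ?thesis .
qed

text \<open>The loop \<open>g'\<^sup>-\<^sup>1 g = h' (h K)\<^sup>-\<^sup>1\<close> extends to both sides of the circle and tends to \<open>I\<close> at infinity.
  The constant \<open>K\<close> is the gauge by which two extended frames may differ at a given point \<open>z\<close>.
  Adjugates replace the inverses, since the determinants of the extensions are
  only given on the circle.\<close>

lemma birkhoff_minus_factor_unique:
  assumes g: "g \<in> Loop_minus_star p" and g': "g' \<in> Loop_minus_star p"
    and h: "h \<in> Loop_plus p" and h': "h' \<in> Loop_plus p"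
    and eq: "\<And>\<theta>. \<theta> \<in> unit_circle \<Longrightarrow> g \<theta> ** h \<theta> ** K = g' \<theta> ** h' \<theta>"
    and \<theta>: "\<theta> \<in> unit_circle"
  shows "g \<theta> = g' \<theta>"
proof -
  obtain G where G: "\<And>\<theta>. \<theta> \<in> unit_circle \<Longrightarrow> G \<theta> = g \<theta>"
    "\<And>i j. continuous_on (- ball 0 1) (\<lambda>\<theta>. G \<theta> $ i $ j)"
    "\<And>i j. (\<lambda>\<theta>. G \<theta> $ i $ j) holomorphic_on (- cball 0 1)"
    "(G \<longlongrightarrow> mat 1) at_infinity"
    using g unfolding Loop_minus_star_def by blast
  obtain G' where G': "\<And>\<theta>. \<theta> \<in> unit_circle \<Longrightarrow> G' \<theta> = g' \<theta>"
    "\<And>i j. continuous_on (- ball 0 1) (\<lambda>\<theta>. G' \<theta> $ i $ j)"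
    "\<And>i j. (\<lambda>\<theta>. G' \<theta> $ i $ j) holomorphic_on (- cball 0 1)"
    "(G' \<longlongrightarrow> mat 1) at_infinity"
    using g' unfolding Loop_minus_star_def by blast
  obtain P where P: "\<And>\<theta>. \<theta> \<in> unit_circle \<Longrightarrow> P \<theta> = h \<theta>"
    "\<And>i j. continuous_on (cball 0 1) (\<lambda>\<theta>. P \<theta> $ i $ j)"
    "\<And>i j. (\<lambda>\<theta>. P \<theta> $ i $ j) holomorphic_on ball 0 1"
    using h unfolding Loop_plus_def by blast
  obtain P' where P': "\<And>\<theta>. \<theta> \<in> unit_circle \<Longrightarrow> P' \<theta> = h' \<theta>"
    "\<And>i j. continuous_on (cball 0 1) (\<lambda>\<theta>. P' \<theta> $ i $ j)"
    "\<And>i j. (\<lambda>\<theta>. P' \<theta> $ i $ j) holomorphic_on ball 0 1"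
    using h' unfolding Loop_plus_def by blast
  have det: "det (g \<theta>) = 1" "det (g' \<theta>) = 1" "det (h \<theta>) = 1" "det (h' \<theta>) = 1"
    if "\<theta> \<in> unit_circle" for \<theta>
    using that g g' h h' by (auto simp: Loop_minus_star_def Loop_plus_def Loop_SL2_def)
  define inside where "inside w = P' w ** adjugate2 (P w ** K)" for w
  define outside where "outside w = adjugate2 (G' w) ** G w" for w
  have match: "inside \<theta> = outside \<theta>" if t: "\<theta> \<in> unit_circle" for \<theta>
  proof -
    have "det (g \<theta> ** h \<theta> ** K) = det (g' \<theta> ** h' \<theta>)"
      by (simp add: eq[OF t])
    then have "det K = 1"
      by (simp add: det_mul det[OF t])
    then have inv: "(h \<theta> ** K) ** adjugate2 (h \<theta> ** K) = mat 1" "adjugate2 (g' \<theta>) ** g' \<theta> = mat 1"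
      by (simp_all add: adjugate2_mult det_mul det[OF t])
    have "inside \<theta> = (adjugate2 (g' \<theta>) ** g' \<theta>) ** h' \<theta> ** adjugate2 (h \<theta> ** K)"
      by (simp add: inside_def P(1)[OF t] P'(1)[OF t] inv)
    also have "\<dots> = adjugate2 (g' \<theta>) ** (g' \<theta> ** h' \<theta>) ** adjugate2 (h \<theta> ** K)"
      by (simp add: matrix_mul_assoc)
    also have "\<dots> = adjugate2 (g' \<theta>) ** (g \<theta> ** (h \<theta> ** K)) ** adjugate2 (h \<theta> ** K)"
      by (simp add: eq[OF t, symmetric] matrix_mul_assoc)
    also have "\<dots> = adjugate2 (g' \<theta>) ** g \<theta> ** ((h \<theta> ** K) ** adjugate2 (h \<theta> ** K))"
      by (simp add: matrix_mul_assoc)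
    finally show ?thesis
      by (simp add: inv outside_def G(1)[OF t] G'(1)[OF t])
  qed
  have lim: "((\<lambda>w. outside w $ i $ j) \<longlongrightarrow> (mat 1 :: complex^2^2) $ i $ j) at_infinity" for i j
  proof -
    have "((\<lambda>w. G w $ i $ j) \<longlongrightarrow> (mat 1 :: complex^2^2) $ i $ j) at_infinity"
      "((\<lambda>w. G' w $ i $ j) \<longlongrightarrow> (mat 1 :: complex^2^2) $ i $ j) at_infinity" for i j
      using G(4) G'(4) by (intro tendsto_vec_nth; simp)+
    then have "((\<lambda>w. outside w $ i $ j) \<longlongrightarrow> (adjugate2 (mat 1) ** mat 1) $ i $ j) at_infinity"
      using exhaust_2[of i]
      by (auto simp: outside_def adjugate2_def cmat2_def matrix_matrix_mult_def sum_2
          intro!: tendsto_add tendsto_mult tendsto_minus)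
    moreover have "adjugate2 (mat 1) ** mat 1 = mat 1"
      using adjugate2_mult(1)[of "mat 1"] by (simp only: det_I)
    ultimately show ?thesis by simp
  qed
  have "outside \<theta> $ i $ j = (mat 1 :: complex^2^2) $ i $ j" for i j
  proof (rule holomorphic_inside_outside_eq_limit[where a = "\<lambda>w. inside w $ i $ j" and b = "\<lambda>w. outside w $ i $ j", OF _ _ _ _ lim _ \<theta>])
    show "continuous_on (cball 0 1) (\<lambda>w. inside w $ i $ j)" "(\<lambda>w. inside w $ i $ j) holomorphic_on ball 0 1"
      "continuous_on (- ball 0 1) (\<lambda>w. outside w $ i $ j)" "(\<lambda>w. outside w $ i $ j) holomorphic_on (- cball 0 1)"
      using exhaust_2[of i] exhaust_2[of j] G(2,3) G'(2,3) P(2,3) P'(2,3)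
      by (auto simp: inside_def outside_def adjugate2_def cmat2_def matrix_matrix_mult_def sum_2
          intro!: holomorphic_on_add holomorphic_on_diff holomorphic_on_mult holomorphic_on_minus holomorphic_on_const
            continuous_on_add continuous_on_diff continuous_on_mult continuous_on_minus continuous_on_const)
  qed (simp add: match)
  then have "adjugate2 (g' \<theta>) ** g \<theta> = mat 1"
    by (simp add: vec_eq_iff outside_def G(1)[OF \<theta>] G'(1)[OF \<theta>])
  then have "g' \<theta> ** adjugate2 (g' \<theta>) ** g \<theta> = g' \<theta>"
    by (simp add: matrix_mul_assoc[symmetric])
  then show ?thesis
    by (simp add: adjugate2_mult det[OF \<theta>])
qed

section \<open>Uniqueness of extended frames and normalized potentials\<close>

lemma extended_frame_wirtinger:
  assumes "extended_frame p D n F" "open D" "z \<in> D" "\<theta> \<in> unit_circle"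
  shows "det (F z \<theta>) = 1"
    and "has_mat_wirtinger (\<lambda>w. F w \<theta>) z (mat_z (\<lambda>w. F w \<theta>) z) (mat_zbar (\<lambda>w. F w \<theta>) z)"
  using assms unfolding extended_frame_def Loop_SU2_def Loop_SL2_def
  by (auto intro!: smooth_on_mat_wirtinger)

text \<open>The stabilizer of the third unit vector consists of the matrices that commute with a diagonal
  matrix with distinct eigenvalues.\<close>

lemma projects_to_same_diagonal:
  assumes "det A = 1" "det B = 1" "projects_to A n" "projects_to B n"
  shows "diagonal2 (matrix_inv A ** B)"
proof -
  define T where "T = su2_of (axis 3 1)"
  define K where "K = matrix_inv A ** B"
  have "matrix_inv A ** (A ** T ** matrix_inv A) ** B = matrix_inv A ** (B ** T ** matrix_inv B) ** B"
    using assms(3,4) by (simp add: projects_to_def T_def)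
  moreover have "matrix_inv A ** (A ** T ** matrix_inv A) ** B = (matrix_inv A ** A) ** T ** K"
    by (simp add: K_def matrix_mul_assoc)
  moreover have "matrix_inv A ** (B ** T ** matrix_inv B) ** B = K ** T ** (matrix_inv B ** B)"
    by (simp add: K_def matrix_mul_assoc[symmetric])
  ultimately have "T ** K = K ** T"
    by (simp add: matrix_inv_det_1 assms)
  then have "diagonal2 K"
    by (auto simp: vec_eq_iff forall_2 matrix_matrix_mult_def sum_2 T_def su2_of_def cmat2_def
        axis_def diagonal2_def)
  then show ?thesis
    by (simp add: K_def)
qed

text \<open>Let \<open>K\<close> be the transition matrix at \<open>\<theta> = 1\<close>; it is diagonal because both frames project to \<open>n\<close>.
  The off-diagonal part of \<open>dK = K \<alpha>' - \<alpha> K\<close> says that \<open>K\<close> intertwines the off-diagonal parts of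
  \<open>\<alpha>\<close> and \<open>\<alpha>'\<close>. These are the only parts that are rescaled by \<open>\<theta>\<close>, so \<open>K\<close> is a gauge
  transformation for every \<open>\<theta>\<close>, and \<open>F K F'\<^sup>-\<^sup>1\<close> keeps its value \<open>I\<close> at \<open>0\<close>.\<close>

lemma extended_frame_unique_up_to_gauge:
  assumes D: "open D" "connected D" "0 \<in> D"
    and F: "extended_frame p D n F" and F': "extended_frame p D n F'"
    and z: "z \<in> D" and \<theta>: "\<theta> \<in> unit_circle"
  shows "F' z \<theta> = F z \<theta> ** (matrix_inv (F z 1) ** F' z 1)"
proof -
  define K where "K w = matrix_inv (F w 1) ** F' w 1" for w
  have one: "1 \<in> unit_circle" by simp
  note det = extended_frame_wirtinger(1)[OF F D(1)] extended_frame_wirtinger(1)[OF F' D(1)]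
  have diag: "diagonal2 (K w)" if "w \<in> D" for w
    unfolding K_def using projects_to_same_diagonal det[OF that one] F F' that
    unfolding extended_frame_def by blast
  define G where "G w = F w \<theta> ** K w ** matrix_inv (F' w \<theta>)" for w
  have "has_mat_wirtinger G w 0 0" if w: "w \<in> D" for w
  proof -
    obtain A B A' B' where AB: "offdiagonal2 A" "offdiagonal2 A'" "diagonal2 B" "diagonal2 B'"
      "\<And>\<theta>. \<theta> \<in> unit_circle \<Longrightarrow> matrix_inv (F w \<theta>) ** mat_z (\<lambda>w. F w \<theta>) w = mat (1 / \<theta>) ** A + B"
      "\<And>\<theta>. \<theta> \<in> unit_circle \<Longrightarrow> matrix_inv (F w \<theta>) ** mat_zbar (\<lambda>w. F w \<theta>) w = mat \<theta> ** A' + B'"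
      using F w unfolding extended_frame_def by metis
    obtain P Q P' Q' where PQ: "offdiagonal2 P" "offdiagonal2 P'" "diagonal2 Q" "diagonal2 Q'"
      "\<And>\<theta>. \<theta> \<in> unit_circle \<Longrightarrow> matrix_inv (F' w \<theta>) ** mat_z (\<lambda>w. F' w \<theta>) w = mat (1 / \<theta>) ** P + Q"
      "\<And>\<theta>. \<theta> \<in> unit_circle \<Longrightarrow> matrix_inv (F' w \<theta>) ** mat_zbar (\<lambda>w. F' w \<theta>) w = mat \<theta> ** P' + Q'"
      using F' w unfolding extended_frame_def by metis
    have dF: "has_mat_wirtinger (\<lambda>w. F w t) w (F w t ** (mat (1 / t) ** A + B)) (F w t ** (mat t ** A' + B'))"
      if "t \<in> unit_circle" for t
      using extended_frame_wirtinger[OF F D(1) w that] AB(5,6)[OF that] eq_mult_of_inv_mult_eq by metis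
    have dF': "has_mat_wirtinger (\<lambda>w. F' w t) w (F' w t ** (mat (1 / t) ** P + Q)) (F' w t ** (mat t ** P' + Q'))"
      if "t \<in> unit_circle" for t
      using extended_frame_wirtinger[OF F' D(1) w that] PQ(5,6)[OF that] eq_mult_of_inv_mult_eq by metis
    have dK: "has_mat_wirtinger K w (K w ** (P + Q) - (A + B) ** K w) (K w ** (P' + Q') - (A' + B') ** K w)"
      unfolding K_def
      using has_mat_wirtinger_transition[OF dF[OF one] dF'[OF one] D(1) w det(1)[OF _ one]]
      by simp
    (* the off-diagonal entries of K vanish near w, and so do those of its derivatives *)
    have off0: "(K w ** (P + Q) - (A + B) ** K w) $ i $ j = 0"
               "(K w ** (P' + Q') - (A' + B') ** K w) $ i $ j = 0" if "i \<noteq> j" for i j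
    proof -
      have "K v $ i $ j = 0" if "v \<in> D" for v
        using diag[OF that] \<open>i \<noteq> j\<close> exhaust_2[of i] exhaust_2[of j] by (auto simp: diagonal2_def)
      then show "(K w ** (P + Q) - (A + B) ** K w) $ i $ j = 0"
                "(K w ** (P' + Q') - (A' + B') ** K w) $ i $ j = 0"
        using has_wirtinger_constant_on[OF _ D(1) w] dK unfolding has_mat_wirtinger_def by blast+
    qed
    have comm: "A ** K w = K w ** P" "A' ** K w = K w ** P'"
      using off0[of 1 2] off0[of 2 1] diag[OF w] AB(1-4) PQ(1-4)
      by (simp_all add: vec_eq_iff forall_2 matrix_matrix_mult_def sum_2 diagonal2_def offdiagonal2_def)
    have "mat t ** A ** K w = K w ** (mat t ** P)" "mat t ** A' ** K w = K w ** (mat t ** P')" for t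
      using comm matrix_mul_mat_commute by (metis matrix_mul_assoc)+
    then have "(mat t ** A + B) ** K w + (K w ** (P + Q) - (A + B) ** K w) - K w ** (mat t ** P + Q) = 0"
         "(mat t ** A' + B') ** K w + (K w ** (P' + Q') - (A' + B') ** K w) - K w ** (mat t ** P' + Q') = 0" for t
      using comm by (simp_all add: matrix_add_ldistrib matrix_add_rdistrib)
    then show ?thesis
      unfolding G_def
      using has_mat_wirtinger_gauge[OF dF[OF \<theta>] dK dF'[OF \<theta>] D(1) w det(2)[OF _ \<theta>]] by simp
  qed
  then have "G z = G 0"
    using has_mat_wirtinger_zero_constant D z by blast
  also have "\<dots> = mat 1"
  proof -
    have "F 0 t = mat 1" "F' 0 t = mat 1" if "t \<in> unit_circle" for t
      using F F' that unfolding extended_frame_def by auto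
    moreover have "matrix_inv (mat 1 :: complex^2^2) = mat 1"
      using matrix_inv_det_1[of "mat 1 :: complex^2^2"] by simp
    ultimately show ?thesis
      using \<theta> one by (simp add: G_def K_def)
  qed
  finally have "G z ** F' z \<theta> = F' z \<theta>"
    by simp
  moreover have "G z ** F' z \<theta> = F z \<theta> ** K z ** (matrix_inv (F' z \<theta>) ** F' z \<theta>)"
    by (simp add: G_def matrix_mul_assoc)
  ultimately show ?thesis
    using matrix_inv_det_1(2)[OF det(2)[OF z \<theta>]] by (simp add: K_def)
qed

text \<open>The value at \<open>z\<close> is determined by the punctured neighbourhood: it is the limit, or \<open>0\<close> at a pole.\<close>

lemma nicely_meromorphic_eq:
  assumes "f nicely_meromorphic_on D" "g nicely_meromorphic_on D" "z \<in> D"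
    and "eventually (\<lambda>w. f w = g w) (at z)"
  shows "f z = g z"
proof -
  have lim: "f \<midarrow>z\<rightarrow> l \<longleftrightarrow> g \<midarrow>z\<rightarrow> l" for l
    using assms(4) by (rule filterlim_cong[OF refl refl])
  have "is_pole f z \<longleftrightarrow> is_pole g z"
    using assms(4) by (rule is_pole_cong) simp
  moreover have "\<not> (is_pole f z \<and> f \<midarrow>z\<rightarrow> l)" for l
    unfolding is_pole_def using not_tendsto_and_filterlim_at_infinity by (metis at_neq_bot)
  ultimately show ?thesis
    using assms(1-3) lim unfolding nicely_meromorphic_on_def by (metis LIM_unique)
qed

lemma normalized_potential_unique:
  assumes D: "open D" "connected D" "0 \<in> D"
    and P: "normalized_potential p D n P" and P': "normalized_potential p D n P'" and z: "z \<in> D"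
  shows "P z = P' z"
proof -
  obtain F S Fm Fp where F: "extended_frame p D n F" and S: "S sparse_in D"
    and fact: "\<forall>z\<in>D - S. Fm z \<in> Loop_minus_star p \<and> Fp z \<in> Loop_plus p \<and>
          (\<forall>\<theta>\<in>unit_circle. F z \<theta> = Fm z \<theta> ** Fp z \<theta>)"
    and mer: "\<forall>i j. (\<lambda>z. P z $ i $ j) nicely_meromorphic_on D \<and>
          (\<lambda>z. P z $ i $ j) holomorphic_on (D - S)"
    and pot: "\<forall>\<theta>\<in>unit_circle. (\<forall>i j. (\<lambda>z. Fm z \<theta> $ i $ j) holomorphic_on (D - S)) \<and>
          (\<forall>z\<in>D - S. P z = mat \<theta> ** matrix_inv (Fm z \<theta>) ** mat_z (\<lambda>w. Fm w \<theta>) z)"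
    using P unfolding normalized_potential_def by (elim conjE exE) (rule that)
  obtain F' S' Fm' Fp' where F': "extended_frame p D n F'" and S': "S' sparse_in D"
    and fact': "\<forall>z\<in>D - S'. Fm' z \<in> Loop_minus_star p \<and> Fp' z \<in> Loop_plus p \<and>
          (\<forall>\<theta>\<in>unit_circle. F' z \<theta> = Fm' z \<theta> ** Fp' z \<theta>)"
    and mer': "\<forall>i j. (\<lambda>z. P' z $ i $ j) nicely_meromorphic_on D \<and>
          (\<lambda>z. P' z $ i $ j) holomorphic_on (D - S')"
    and pot': "\<forall>\<theta>\<in>unit_circle. (\<forall>i j. (\<lambda>z. Fm' z \<theta> $ i $ j) holomorphic_on (D - S')) \<and>
          (\<forall>z\<in>D - S'. P' z = mat \<theta> ** matrix_inv (Fm' z \<theta>) ** mat_z (\<lambda>w. Fm' w \<theta>) z)"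
    using P' unfolding normalized_potential_def by (elim conjE exE) (rule that)
  define E where "E = D - (S \<union> S')"
  have "S \<union> S' sparse_in D"
    using S S' by (rule sparse_in_union')
  then have "open E" and "\<forall>\<^sub>F w in at z. w \<notin> S \<union> S'"
    unfolding E_def using D(1) z open_diff_sparse_pts sparse_in_eventually_iff by blast+
  moreover have "\<forall>\<^sub>F w in at z. w \<in> D"
    using D(1) z by (rule eventually_at_in_open')
  ultimately have ev: "\<forall>\<^sub>F w in at z. w \<in> E"
    unfolding E_def by (auto elim: eventually_elim2)
  have one: "1 \<in> unit_circle" by simp
  have Fm: "Fm w \<theta> = Fm' w \<theta>" if w: "w \<in> E" and \<theta>: "\<theta> \<in> unit_circle" for w \<theta>
  proof (rule birkhoff_minus_factor_unique[OF _ _ _ _ _ \<theta>])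
    show "Fm w \<in> Loop_minus_star p" "Fp w \<in> Loop_plus p" "Fm' w \<in> Loop_minus_star p" "Fp' w \<in> Loop_plus p"
      using w fact fact' by (auto simp: E_def)
    fix t assume t: "t \<in> unit_circle"
    show "Fm w t ** Fp w t ** (matrix_inv (F w 1) ** F' w 1) = Fm' w t ** Fp' w t"
      using extended_frame_unique_up_to_gauge[OF D F F' _ t, of w] fact fact' w t unfolding E_def
      by (metis DiffE DiffI UnCI)
  qed
  have eq: "P w = P' w" if w: "w \<in> E" for w
  proof -
    have "frechet_derivative (\<lambda>v. Fm v 1 $ i $ j) (at w) = frechet_derivative (\<lambda>v. Fm' v 1 $ i $ j) (at w)" for i j
      by (rule frechet_derivative_cong[OF \<open>open E\<close> w]) (simp add: Fm one)
    then have "mat_z (\<lambda>w. Fm w 1) w = mat_z (\<lambda>w. Fm' w 1) w"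
      by (simp add: mat_z_def pd_z_def pd_x_def pd_y_def)
    then show ?thesis
      using pot[rule_format, OF one, THEN conjunct2] pot'[rule_format, OF one, THEN conjunct2]
        Fm[OF w one] w by (simp add: E_def)
  qed
  have "P z $ i $ j = P' z $ i $ j" for i j
    by (rule nicely_meromorphic_eq[OF mer[rule_format, THEN conjunct1] mer'[rule_format, THEN conjunct1] z])
       (use ev eq in \<open>auto elim: eventually_mono\<close>)
  then show ?thesis
    by (simp add: vec_eq_iff)
qed

text \<open>All conditions on \<open>n\<close> are pointwise on \<open>D\<close> or concern derivatives at points of the open set \<open>D\<close>.\<close>

lemma normalized_potential_cong:
  assumes D: "open D" and eq: "\<And>z. z \<in> D \<Longrightarrow> n z = n' z"
  shows "normalized_potential p D n P \<longleftrightarrow> normalized_potential p D n' P"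
proof -
  have cv: "pd_x (\<lambda>w. cvec (n w) $ i) z = pd_x (\<lambda>w. cvec (n' w) $ i) z"
           "pd_y (\<lambda>w. cvec (n w) $ i) z = pd_y (\<lambda>w. cvec (n' w) $ i) z" if "z \<in> D" for z i
    unfolding pd_x_def pd_y_def
    using frechet_derivative_cong[OF D that, of "\<lambda>w. cvec (n w) $ i" "\<lambda>w. cvec (n' w) $ i"] eq by simp_all
  have fz: "f_z n z = f_z n' z" "f_zbar n z = f_zbar n' z" if "z \<in> D" for z
    using cv[OF that]
    by (simp_all add: f_z_def f_zbar_def vec_z_def vec_zbar_def pd_z_def pd_zbar_def)
  have "vec_zbar (f_z n) z = vec_zbar (f_z n') z" if "z \<in> D" for z
    using frechet_derivative_cong[OF D that, of "\<lambda>w. f_z n w $ _" "\<lambda>w. f_z n' w $ _"] fz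
    by (simp add: vec_zbar_def pd_zbar_def pd_x_def pd_y_def)
  then have "harmonic_S2 D n \<longleftrightarrow> harmonic_S2 D n'"
    using Ck_on_cong[OF D eq] fz eq unfolding harmonic_S2_def smooth_on_def by auto
  moreover have "extended_frame p D n = extended_frame p D n'"
    using eq unfolding extended_frame_def by (intro ext) auto
  ultimately show ?thesis
    unfolding normalized_potential_def by simp
qed

section \<open>The Gauss map of a Euclidean surface of constant mean curvature\<close>

lemma f_z_component:
  "f_z f z $ i = pd_z (\<lambda>w. of_real (f w $ i)) z"
  "f_zbar f z $ i = pd_zbar (\<lambda>w. of_real (f w $ i)) z"
  "vec_z (f_z f) z $ i = pd_z (pd_z (\<lambda>w. of_real (f w $ i))) z"
  "vec_zbar (f_z f) z $ i = pd_zbar (pd_z (\<lambda>w. of_real (f w $ i))) z"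
  by (simp_all add: f_z_def f_zbar_def vec_z_def vec_zbar_def cvec_def)

text \<open>Since \<open>f\<close> is real, conjugation exchanges \<open>f_z\<close> and \<open>f_zbar\<close>, and the mixed derivative is real.\<close>

lemma f_z_wirtinger:
  fixes f :: "complex \<Rightarrow> real^'n"
  assumes f: "smooth_on D f" and D: "open D" "z \<in> D"
  shows "has_wirtinger (\<lambda>w. cvec (f w) $ i) z (f_z f z $ i) (f_zbar f z $ i)"
    and "f_zbar f z $ i = cnj (f_z f z $ i)"
    and "has_wirtinger (\<lambda>w. f_z f w $ i) z (vec_z (f_z f) z $ i) (vec_zbar (f_z f) z $ i)"
    and "has_wirtinger (\<lambda>w. f_zbar f w $ i) z (vec_zbar (f_z f) z $ i) (cnj (vec_z (f_z f) z $ i))"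
proof -
  have sm: "smooth_on D (\<lambda>w. f w $ i)"
    using smooth_on_component[OF D(1) f] .
  note d = smooth_on_differentiable[OF sm D(1)]
  show "has_wirtinger (\<lambda>w. cvec (f w) $ i) z (f_z f z $ i) (f_zbar f z $ i)"
    using has_wirtinger_of_real[OF d[OF D(2)]] by (simp add: f_z_component cvec_def)
  have bar: "f_zbar f w $ i = cnj (f_z f w $ i)" if "w \<in> D" for w
    using has_wirtinger_of_real(2)[OF d[OF that]] by (simp add: f_z_component)
  then show "f_zbar f z $ i = cnj (f_z f z $ i)"
    using D(2) .
  show W: "has_wirtinger (\<lambda>w. f_z f w $ i) z (vec_z (f_z f) z $ i) (vec_zbar (f_z f) z $ i)"
    using has_wirtinger_pd_z_of_real(1)[OF sm D] by (simp add: f_z_component)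
  have "cnj (vec_zbar (f_z f) z $ i) = vec_zbar (f_z f) z $ i"
    using has_wirtinger_pd_z_of_real(2)[OF sm D] by (simp add: f_z_component)
  then show "has_wirtinger (\<lambda>w. f_zbar f w $ i) z (vec_zbar (f_z f) z $ i) (cnj (vec_z (f_z f) z $ i))"
    using has_wirtinger_transform[OF has_wirtinger_cnj[OF W] D, of "\<lambda>w. f_zbar f w $ i"] bar by simp
qed

lemma has_wirtinger_bform:
  assumes "\<And>i. has_wirtinger (\<lambda>w. v w $ i) z (a $ i) (b $ i)"
    and "\<And>i. has_wirtinger (\<lambda>w. v' w $ i) z (a' $ i) (b' $ i)"
  shows "has_wirtinger (\<lambda>w. bform \<epsilon> (v w) (v' w)) z
           (bform \<epsilon> a (v' z) + bform \<epsilon> (v z) a') (bform \<epsilon> b (v' z) + bform \<epsilon> (v z) b')"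
proof -
  have "has_wirtinger (\<lambda>w. \<Sum>i\<in>UNIV. of_real (\<epsilon> $ i) * (v w $ i * v' w $ i)) z
      (\<Sum>i\<in>UNIV. of_real (\<epsilon> $ i) * (a $ i * v' z $ i + v z $ i * a' $ i))
      (\<Sum>i\<in>UNIV. of_real (\<epsilon> $ i) * (b $ i * v' z $ i + v z $ i * b' $ i))"
    using assms by (intro has_wirtinger_sum has_wirtinger_cmult has_wirtinger_mult) auto
  then show ?thesis
    by (simp add: bform_def sum.distrib algebra_simps)
qed

lemma bform_commute: "bform \<epsilon> v w = bform \<epsilon> w v"
  by (simp add: bform_def mult_ac)

lemma bform_euclid: "bform euclid_sig v w = v $ 1 * w $ 1 + v $ 2 * w $ 2 + v $ 3 * w $ 3"
  by (simp add: bform_def euclid_sig_def sum_3)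

text \<open>The coefficients are read off from the dual basis \<open>\<psi> / r, \<phi> / r, \<nu>\<close>. That three vectors with
  these products span is the fact that a one-sided matrix inverse is two-sided.\<close>

lemma isotropic_frame_expansion:
  fixes \<phi> \<psi> \<nu> w :: "complex^3"
  assumes "r \<noteq> 0"
    and "bform euclid_sig \<phi> \<phi> = 0" "bform euclid_sig \<psi> \<psi> = 0" "bform euclid_sig \<phi> \<psi> = r"
    and "bform euclid_sig \<nu> \<nu> = 1" "bform euclid_sig \<nu> \<phi> = 0" "bform euclid_sig \<nu> \<psi> = 0"
  shows "w $ i = bform euclid_sig \<psi> w / r * \<phi> $ i + bform euclid_sig \<phi> w / r * \<psi> $ i
           + bform euclid_sig \<nu> w * \<nu> $ i"
proof -
  define A :: "complex^3^3" where "A = vector [(1 / r) *s \<psi>, (1 / r) *s \<phi>, \<nu>]"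
  define B :: "complex^3^3" where "B = transpose (vector [\<phi>, \<psi>, \<nu>])"
  have "A ** B = mat 1"
    using assms
    by (simp add: A_def B_def transpose_def matrix_matrix_mult_def vec_eq_iff forall_3 sum_3 mat_def
        bform_euclid field_simps)
  then have "B ** A = mat 1"
    by (rule matrix_left_right_inverse1)
  then have "(B ** A) *v w = w"
    by simp
  then have "B *v (A *v w) = w"
    by (simp add: matrix_vector_mul_assoc)
  then have "w $ i = (B *v (A *v w)) $ i"
    by simp
  then show ?thesis
    by (simp add: A_def B_def transpose_def matrix_vector_mult_def sum_3 bform_euclid algebra_simps add_divide_distrib)
qed

text \<open>Differentiating the relations between \<open>f_z\<close>, \<open>f_zbar\<close> and \<open>N\<close> gives all products of the
  derivatives with these three vectors, and \<open>isotropic_frame_expansion\<close> turns the products into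
  coefficients.\<close>

lemma gauss_weingarten:
  assumes D: "open D" "z \<in> D" and S: "cmc_E3 D f N u c"
  defines "Q \<equiv> hopf euclid_sig f N" and "uz \<equiv> pd_z (\<lambda>w. of_real (u w)) z"
  shows "vec_z (f_z f) z $ i = 2 * uz * f_z f z $ i + Q z * of_real (N z $ i)"
    and "vec_zbar (f_z f) z $ i = of_real (c * exp (2 * u z) / 2) * of_real (N z $ i)"
    and "f_z N z $ i = - of_real c * f_z f z $ i - 2 * of_real (exp (- 2 * u z)) * Q z * f_zbar f z $ i"
proof -
  have f: "smooth_on D f" and u: "smooth_on D u" and N: "smooth_on D N"
    and conf: "\<And>w. w \<in> D \<Longrightarrow> bform euclid_sig (f_z f w) (f_z f w) = 0"
      "\<And>w. w \<in> D \<Longrightarrow> bform euclid_sig (f_z f w) (f_zbar f w) = of_real (exp (2 * u w) / 2)"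
    and nor: "\<And>w. w \<in> D \<Longrightarrow> bform euclid_sig (cvec (N w)) (cvec (N w)) = 1"
      "\<And>w. w \<in> D \<Longrightarrow> bform euclid_sig (cvec (N w)) (f_z f w) = 0"
    and mean: "bform euclid_sig (vec_zbar (f_z f) z) (cvec (N z)) = of_real (c * exp (2 * u z) / 2)"
    using S D(2) unfolding cmc_E3_def conformal_immersion_def unit_normal_def const_mean_curvature_def by auto
  have bar: "f_zbar f w $ i = cnj (f_z f w $ i)" if "w \<in> D" for w i
    using f_z_wirtinger(2)[OF f D(1) that] .
  have "bform euclid_sig (f_zbar f w) (f_zbar f w) = cnj (bform euclid_sig (f_z f w) (f_z f w))"
       "bform euclid_sig (cvec (N w)) (f_zbar f w) = cnj (bform euclid_sig (cvec (N w)) (f_z f w))" if "w \<in> D" for w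
    by (simp_all add: bform_euclid bar[OF that] cvec_def)
  then have conf': "bform euclid_sig (f_zbar f w) (f_zbar f w) = 0"
    and nor': "bform euclid_sig (cvec (N w)) (f_zbar f w) = 0" if "w \<in> D" for w
    using that conf nor by simp_all
  define \<phi> \<psi> \<nu> where "\<phi> = f_z f z" and "\<psi> = f_zbar f z" and "\<nu> = cvec (N z)"
  define p q m where "p = vec_z (f_z f) z" and "q = vec_zbar (f_z f) z" and "m = f_z N z"
  define r where "r = complex_of_real (exp (2 * u z)) / 2"
  have d\<phi>: "has_wirtinger (\<lambda>w. f_z f w $ i) z (p $ i) (q $ i)" for i
    unfolding p_def q_def using f_z_wirtinger(3)[OF f D] .
  have d\<psi>: "has_wirtinger (\<lambda>w. f_zbar f w $ i) z (q $ i) ((\<chi> i. cnj (p $ i)) $ i)" for i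
    unfolding p_def q_def using f_z_wirtinger(4)[OF f D] by simp
  have d\<nu>: "has_wirtinger (\<lambda>w. cvec (N w) $ i) z (m $ i) (f_zbar N z $ i)" for i
    unfolding m_def using f_z_wirtinger(1)[OF N D] .
  have "has_wirtinger (\<lambda>w. of_real (u w)) z uz (cnj uz)"
    unfolding uz_def using has_wirtinger_of_real(1)[OF smooth_on_differentiable[OF u D]] .
  from has_wirtinger_cmult[OF has_wirtinger_exp[OF has_wirtinger_cmult[OF this, of 2]], of "1/2"]
  have dr: "has_wirtinger (\<lambda>w. bform euclid_sig (f_z f w) (f_zbar f w)) z
      (1 / 2 * (exp (2 * of_real (u z)) * (2 * uz))) (1 / 2 * (exp (2 * of_real (u z)) * (2 * cnj uz)))"
    by (rule has_wirtinger_transform[OF _ D]) (simp add: conf exp_of_real[symmetric])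
  let ?b = "bform euclid_sig"
  have e1: "?b p \<phi> + ?b \<phi> p = 0" "?b q \<phi> + ?b \<phi> q = 0"
    using has_wirtinger_constant_on[OF has_wirtinger_bform[OF d\<phi> d\<phi>] D conf(1)] unfolding \<phi>_def by blast+
  have e2: "?b q \<psi> + ?b \<psi> q = 0"
    using has_wirtinger_constant_on(1)[OF has_wirtinger_bform[OF d\<psi> d\<psi>] D conf'] unfolding \<psi>_def by blast+
  have e3: "?b p \<psi> + ?b \<phi> q = 2 * r * uz"
    using has_wirtinger_unique(1)[OF has_wirtinger_bform[OF d\<phi> d\<psi>] dr] unfolding \<phi>_def \<psi>_def r_def
    by (simp add: exp_of_real[symmetric])
  have e4: "?b m \<nu> + ?b \<nu> m = 0"
    using has_wirtinger_constant_on(1)[OF has_wirtinger_bform[OF d\<nu> d\<nu>] D nor(1)] unfolding \<nu>_def by blast+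
  have e5: "?b m \<phi> + ?b \<nu> p = 0"
    using has_wirtinger_constant_on(1)[OF has_wirtinger_bform[OF d\<nu> d\<phi>] D nor(2)] unfolding \<nu>_def \<phi>_def by blast+
  have e6: "?b m \<psi> + ?b \<nu> q = 0"
    using has_wirtinger_constant_on(1)[OF has_wirtinger_bform[OF d\<nu> d\<psi>] D nor'] unfolding \<nu>_def \<psi>_def by blast+
  have Q: "?b \<nu> p = Q z"
    unfolding Q_def hopf_def p_def \<nu>_def by (rule bform_commute)
  have H: "?b \<nu> q = of_real c * r"
    using mean by (simp add: q_def \<nu>_def r_def bform_commute)
  have r: "r \<noteq> 0" "inverse r = 2 * of_real (exp (- 2 * u z))"
    by (simp_all add: r_def exp_minus field_simps)
  have expand: "w $ i = ?b \<psi> w / r * \<phi> $ i + ?b \<phi> w / r * \<psi> $ i + ?b \<nu> w * \<nu> $ i" for w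
    using conf[OF D(2)] conf'[OF D(2)] nor[OF D(2)] nor'[OF D(2)]
    by (intro isotropic_frame_expansion r) (simp_all add: \<phi>_def \<psi>_def \<nu>_def r_def)
  have p: "?b \<phi> p = 0" "?b \<psi> p = 2 * r * uz" and q: "?b \<phi> q = 0" "?b \<psi> q = 0"
    and m: "?b \<nu> m = 0" "?b \<phi> m = - Q z" "?b \<psi> m = - (of_real c * r)"
    using e1 e2 e3 e4 e5 e6 Q H
    by (simp_all add: bform_commute[of _ p \<phi>] bform_commute[of _ p \<psi>] bform_commute[of _ q \<phi>]
        bform_commute[of _ q \<psi>] bform_commute[of _ m] eq_neg_iff_add_eq_0)
  have \<nu>: "\<nu> $ i = of_real (N z $ i)"
    by (simp add: \<nu>_def cvec_def)
  show "vec_z (f_z f) z $ i = 2 * uz * f_z f z $ i + Q z * of_real (N z $ i)"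
    using expand[of p] r(1) unfolding p Q \<nu> by (simp add: p_def \<phi>_def)
  show "vec_zbar (f_z f) z $ i = of_real (c * exp (2 * u z) / 2) * of_real (N z $ i)"
    using expand[of q] unfolding q H \<nu> by (simp add: q_def r_def)
  show "f_z N z $ i = - of_real c * f_z f z $ i - 2 * of_real (exp (- 2 * u z)) * Q z * f_zbar f z $ i"
  proof -
    have "- (of_real c * r) / r = - of_real c"
      using r(1) by simp
    moreover have "- Q z / r = - (2 * of_real (exp (- 2 * u z)) * Q z)"
      unfolding divide_inverse r(2) by simp
    ultimately show ?thesis
      using expand[of m] unfolding m by (simp add: m_def \<phi>_def \<psi>_def)
  qed
qed

text \<open>This is \<open>su2_of\<close> of the \<open>i\<close>-th row of the orthonormal frame \<open>(e\<^sup>-\<^sup>u f_x, e\<^sup>-\<^sup>u f_y, N)\<close>, written with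
  \<open>f_z = (f_x - \<i> f_y) / 2\<close>.\<close>

definition frame_row :: "(complex \<Rightarrow> real^3) \<Rightarrow> (complex \<Rightarrow> real^3) \<Rightarrow> (complex \<Rightarrow> real) \<Rightarrow> 3 \<Rightarrow> complex \<Rightarrow> complex^2^2" where
  "frame_row f N u i z = cmat2
     (- \<i> / 2 * of_real (N z $ i)) (\<i> * of_real (exp (- u z)) * f_z f z $ i)
     (\<i> * of_real (exp (- u z)) * f_zbar f z $ i) (\<i> / 2 * of_real (N z $ i))"

text \<open>The coefficients of the Gauss-Weingarten equations are the same for every Cartesian component \<open>i\<close>
  of the frame. They act on the rows of the frame as the adjoint action of \<open>su(2)\<close>, which is why each
  row satisfies one and the same Lax equation.\<close>

lemma frame_row_lax_equation:
  assumes D: "open D" "z \<in> D" and S: "cmc_E3 D f N u c"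
  defines "A \<equiv> MC_z u (hopf euclid_sig f N) c 1 z" and "B \<equiv> MC_zbar u (hopf euclid_sig f N) c 1 z"
  shows "has_mat_wirtinger (frame_row f N u i) z
           (frame_row f N u i z ** A - A ** frame_row f N u i z)
           (frame_row f N u i z ** B - B ** frame_row f N u i z)"
proof -
  define Q where "Q = hopf euclid_sig f N z"
  define uz where "uz = pd_z (\<lambda>w. of_real (u w)) z"
  define e where "e = complex_of_real (exp (u z))"
  define g where "g = complex_of_real (exp (- u z))"
  define \<phi> \<psi> \<nu> where "\<phi> = f_z f z $ i" and "\<psi> = f_zbar f z $ i" and "\<nu> = complex_of_real (N z $ i)"
  have f: "smooth_on D f" and u: "smooth_on D u" and N: "smooth_on D N"
    using S unfolding cmc_E3_def conformal_immersion_def unit_normal_def by auto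
  note du = has_wirtinger_of_real[OF smooth_on_differentiable[OF u D]]
  have sq: "complex_of_real (exp (2 * u z)) = e * e" "complex_of_real (exp (- (2 * u z))) = g * g"
    by (simp_all add: e_def g_def flip: of_real_mult exp_add)
  have ubar: "pd_zbar (\<lambda>w. of_real (u w)) z = cnj uz"
    using du(2) by (simp add: uz_def)
  have "has_wirtinger (\<lambda>w. exp (- 1 * of_real (u w))) z (g * (- 1 * uz)) (g * (- 1 * cnj uz))"
    using has_wirtinger_exp[OF has_wirtinger_cmult[OF du(1), of "-1"]]
    by (simp add: g_def uz_def exp_of_real[symmetric])
  from has_wirtinger_cmult[OF this, of \<i>]
  have dg: "has_wirtinger (\<lambda>w. \<i> * of_real (exp (- u w))) z (\<i> * (- g * uz)) (\<i> * (- g * cnj uz))"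
    by (simp add: exp_of_real[symmetric])
  note gw = gauss_weingarten[OF D S, of i, folded Q_def uz_def \<phi>_def \<psi>_def \<nu>_def]
  have cc: "cnj \<phi> = \<psi>" "cnj \<psi> = \<phi>" "cnj \<nu> = \<nu>" "cnj e = e" "cnj g = g"
    using f_z_wirtinger(2)[OF f D, of i] by (simp_all add: \<phi>_def \<psi>_def \<nu>_def e_def g_def)
  have d\<phi>: "has_wirtinger (\<lambda>w. f_z f w $ i) z (2 * uz * \<phi> + Q * \<nu>) (of_real c * (e * e) / 2 * \<nu>)"
    using f_z_wirtinger(3)[OF f D, of i] by (simp add: gw sq)
  have d\<psi>: "has_wirtinger (\<lambda>w. f_zbar f w $ i) z (of_real c * (e * e) / 2 * \<nu>) (2 * cnj uz * \<psi> + cnj Q * \<nu>)"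
    using f_z_wirtinger(4)[OF f D, of i] by (simp add: gw sq cc)
  have d\<nu>: "has_wirtinger (\<lambda>w. of_real (N w $ i)) z (- of_real c * \<phi> - 2 * (g * g) * Q * \<psi>)
      (- of_real c * \<psi> - 2 * (g * g) * cnj Q * \<phi>)"
    using f_z_wirtinger(1)[OF N D, of i] f_z_wirtinger(2)[OF N D, of i]
    by (simp add: cvec_def gw sq cc)
  have A: "A = cmat2 (- uz / 2) (- g * Q) (e * of_real c / 2) (uz / 2)"
    and B: "B = cmat2 (cnj uz / 2) (- (e * of_real c / 2)) (g * cnj Q) (- cnj uz / 2)"
    by (simp_all add: A_def B_def MC_z_def MC_zbar_def Let_def Q_def ubar g_def e_def uz_def)
  have Y: "frame_row f N u i z = cmat2 (- \<i> / 2 * \<nu>) (\<i> * g * \<phi>) (\<i> * g * \<psi>) (\<i> / 2 * \<nu>)"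
    by (simp add: frame_row_def g_def \<phi>_def \<psi>_def \<nu>_def)
  note entries = has_wirtinger_cmult[OF d\<nu>, of "- \<i> / 2"] has_wirtinger_mult[OF dg d\<phi>]
    has_wirtinger_mult[OF dg d\<psi>] has_wirtinger_cmult[OF d\<nu>, of "\<i> / 2"]
  note entries = entries[folded g_def \<phi>_def \<psi>_def]
  have entry: "has_wirtinger h z a' b'" if "has_wirtinger h z a b" "a = a'" "b = b'" for h a b a' b'
    using that by simp
  have g0: "g \<noteq> 0" and eg1: "e = 1 / g"
    by (simp_all add: g_def e_def exp_minus inverse_eq_divide)
  have commutator: "(X ** Z - Z ** X) $ k $ l =
      X $ k $ 1 * Z $ 1 $ l + X $ k $ 2 * Z $ 2 $ l - (Z $ k $ 1 * X $ 1 $ l + Z $ k $ 2 * X $ 2 $ l)"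
    for X Z :: "complex^2^2" and k l
    by (simp add: matrix_matrix_mult_def sum_2)
  show ?thesis
    unfolding has_mat_wirtinger_def forall_2
  proof (intro conjI)
    show "has_wirtinger (\<lambda>w. frame_row f N u i w $ 1 $ 1) z
        ((frame_row f N u i z ** A - A ** frame_row f N u i z) $ 1 $ 1)
        ((frame_row f N u i z ** B - B ** frame_row f N u i z) $ 1 $ 1)"
      unfolding Y A B commutator cmat2_nth unfolding frame_row_def cmat2_nth
      by (rule entry[OF entries(1)]; use g0 in \<open>simp add: eg1 field_simps\<close>)
    show "has_wirtinger (\<lambda>w. frame_row f N u i w $ 1 $ 2) z
        ((frame_row f N u i z ** A - A ** frame_row f N u i z) $ 1 $ 2)
        ((frame_row f N u i z ** B - B ** frame_row f N u i z) $ 1 $ 2)"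
      unfolding Y A B commutator cmat2_nth unfolding frame_row_def cmat2_nth
      by (rule entry[OF entries(2)]; use g0 in \<open>simp add: eg1 field_simps\<close>)
    show "has_wirtinger (\<lambda>w. frame_row f N u i w $ 2 $ 1) z
        ((frame_row f N u i z ** A - A ** frame_row f N u i z) $ 2 $ 1)
        ((frame_row f N u i z ** B - B ** frame_row f N u i z) $ 2 $ 1)"
      unfolding Y A B commutator cmat2_nth unfolding frame_row_def cmat2_nth
      by (rule entry[OF entries(3)]; use g0 in \<open>simp add: eg1 field_simps\<close>)
    show "has_wirtinger (\<lambda>w. frame_row f N u i w $ 2 $ 2) z
        ((frame_row f N u i z ** A - A ** frame_row f N u i z) $ 2 $ 2)
        ((frame_row f N u i z ** B - B ** frame_row f N u i z) $ 2 $ 2)"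
      unfolding Y A B commutator cmat2_nth unfolding frame_row_def cmat2_nth
      by (rule entry[OF entries(4)]; use g0 in \<open>simp add: eg1 field_simps\<close>)
  qed
qed

text \<open>By the Lax equation \<open>F Y F\<^sup>-\<^sup>1\<close> is constant for each row \<open>Y\<close>, with value \<open>Y\<close> at \<open>0\<close>. Contracting the
  rows at \<open>z\<close> with the components of \<open>N z\<close> gives the third basis vector, because the frame is
  orthonormal, and so the left-hand sides combine to the projection of \<open>F z\<close>. Contracting the rows
  at \<open>0\<close> instead gives the coordinates of \<open>N z\<close> in the frame at \<open>0\<close>.\<close>

lemma adjusted_gauss_map_eq_based_gauss_map:
  assumes D: "open D" "connected D" "0 \<in> D" and S: "cmc_E3 D f N u c"
    and F: "\<And>z. z \<in> D \<Longrightarrow> det (F z) = 1" "smooth_on D F" "F 0 = mat 1"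
      "\<And>z. z \<in> D \<Longrightarrow> matrix_inv (F z) ** mat_z F z = MC_z u (hopf euclid_sig f N) c 1 z"
      "\<And>z. z \<in> D \<Longrightarrow> matrix_inv (F z) ** mat_zbar F z = MC_zbar u (hopf euclid_sig f N) c 1 z"
    and n: "projects_to (F z) n" and z: "z \<in> D"
  shows "n = based_gauss_map f N z"
proof -
  define Y where "Y = frame_row f N u"
  define C where "C i w = F w ** Y i w ** matrix_inv (F w)" for i w
  have "has_mat_wirtinger (C i) w 0 0" if w: "w \<in> D" for i w
  proof -
    have dF: "has_mat_wirtinger F w (F w ** MC_z u (hopf euclid_sig f N) c 1 w)
        (F w ** MC_zbar u (hopf euclid_sig f N) c 1 w)"
      using smooth_on_mat_wirtinger[OF F(2) D(1) w]
        eq_mult_of_inv_mult_eq[OF F(1)[OF w] F(4)[OF w]] eq_mult_of_inv_mult_eq[OF F(1)[OF w] F(5)[OF w]] by simp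
    show ?thesis
      unfolding C_def Y_def
      using has_mat_wirtinger_gauge[OF dF frame_row_lax_equation[OF D(1) w S] dF D(1) w F(1)] by simp
  qed
  then have C: "C i z = C i 0" for i
    using has_mat_wirtinger_zero_constant[OF D(1,2) _ z D(3)] by blast
  have inv1: "matrix_inv (mat 1 :: complex^2^2) = mat 1"
    using matrix_inv_det_1[of "mat 1 :: complex^2^2"] by simp
  have C0: "C i 0 = Y i 0" for i
    by (simp add: C_def F(3) inv1)
  have f: "smooth_on D f"
    and conf: "\<And>w. w \<in> D \<Longrightarrow> bform euclid_sig (f_z f w) (f_z f w) = 0"
      "\<And>w. w \<in> D \<Longrightarrow> bform euclid_sig (f_z f w) (f_zbar f w) = of_real (exp (2 * u w) / 2)"
    and nor: "\<And>w. w \<in> D \<Longrightarrow> bform euclid_sig (cvec (N w)) (cvec (N w)) = 1"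
      "\<And>w. w \<in> D \<Longrightarrow> bform euclid_sig (cvec (N w)) (f_z f w) = 0"
    using S unfolding cmc_E3_def conformal_immersion_def unit_normal_def by auto
  define \<nu> where "\<nu> i = complex_of_real (N z $ i)" for i
  (* contraction of the rows with the components of the normal at z *)
  define comb where "comb X = mat (\<nu> 1) ** X 1 + mat (\<nu> 2) ** X 2 + mat (\<nu> 3) ** X 3" for X :: "3 \<Rightarrow> complex^2^2"
  have entry: "comb X $ i $ j = \<nu> 1 * X 1 $ i $ j + \<nu> 2 * X 2 $ i $ j + \<nu> 3 * X 3 $ i $ j" for X i j
    by (simp add: comb_def matrix_matrix_mult_def mat_def if_distrib[of "\<lambda>x. x * _"] cong: if_cong)
  have bar: "f_zbar f z $ i = cnj (f_z f z $ i)" for i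
    using f_z_wirtinger(2)[OF f D(1) z] .
  have n0: "\<nu> 1 * \<nu> 1 + \<nu> 2 * \<nu> 2 + \<nu> 3 * \<nu> 3 = 1"
    "\<nu> 1 * f_z f z $ 1 + \<nu> 2 * f_z f z $ 2 + \<nu> 3 * f_z f z $ 3 = 0"
    using nor[OF z] by (simp_all add: bform_euclid \<nu>_def cvec_def)
  have n1: "\<nu> 1 * f_zbar f z $ 1 + \<nu> 2 * f_zbar f z $ 2 + \<nu> 3 * f_zbar f z $ 3 = 0"
    using arg_cong[OF n0(2), of cnj] by (simp add: bar \<nu>_def)
  have Yz: "comb (\<lambda>i. Y i z) = su2_of (axis 3 1)"
  proof -
    let ?g = "complex_of_real (exp (- u z))"
    have "comb (\<lambda>i. Y i z) = cmat2
        (- \<i> / 2 * (\<nu> 1 * \<nu> 1 + \<nu> 2 * \<nu> 2 + \<nu> 3 * \<nu> 3))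
        (\<i> * ?g * (\<nu> 1 * f_z f z $ 1 + \<nu> 2 * f_z f z $ 2 + \<nu> 3 * f_z f z $ 3))
        (\<i> * ?g * (\<nu> 1 * f_zbar f z $ 1 + \<nu> 2 * f_zbar f z $ 2 + \<nu> 3 * f_zbar f z $ 3))
        (\<i> / 2 * (\<nu> 1 * \<nu> 1 + \<nu> 2 * \<nu> 2 + \<nu> 3 * \<nu> 3))"
      by (simp add: vec_eq_iff forall_2 entry Y_def frame_row_def cmat2_def \<nu>_def algebra_simps add_divide_distrib)
    also have "\<dots> = su2_of (axis 3 1)"
      unfolding n0 n1 by (simp add: su2_of_def axis_def)
    finally show ?thesis .
  qed
  have conj: "comb (\<lambda>i. A ** X i ** B) = A ** comb X ** B" for A B X
    unfolding comb_def matrix_ring_simps matrix_mul_mat_commute[of _ A]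
    by (simp add: matrix_mul_assoc[symmetric])
  have "su2_of n = F z ** comb (\<lambda>i. Y i z) ** matrix_inv (F z)"
    using n unfolding projects_to_def Yz .
  also have "\<dots> = comb (\<lambda>i. C i z)"
    unfolding C_def conj ..
  also have "\<dots> = comb (\<lambda>i. Y i 0)"
    unfolding C C0 ..
  also have "\<dots> = su2_of (based_gauss_map f N z)"
  proof -
    let ?x = "pd_x f 0" and ?y = "pd_y f 0"
    have fz0: "f_z f 0 $ i = (of_real (?x $ i) - \<i> * of_real (?y $ i)) / 2" 
      "f_zbar f 0 $ i = (of_real (?x $ i) + \<i> * of_real (?y $ i)) / 2" for i
    proof -
      note d = smooth_on_differentiable[OF f D(1,3)]
      show *: "f_z f 0 $ i = (of_real (?x $ i) - \<i> * of_real (?y $ i)) / 2"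
        using pd_of_real(2)[OF differentiable_component(1)[OF d]] differentiable_component(2,3)[OF d]
        by (simp add: f_z_component)
      show "f_zbar f 0 $ i = (of_real (?x $ i) + \<i> * of_real (?y $ i)) / 2"
        using f_z_wirtinger(2)[OF f D(1,3), of i] by (simp add: *)
    qed
    have "Re (bform euclid_sig (f_z f 0) (f_z f 0)) = (?x \<bullet> ?x - ?y \<bullet> ?y) / 4"
      "Re (bform euclid_sig (f_z f 0) (f_zbar f 0)) = (?x \<bullet> ?x + ?y \<bullet> ?y) / 4"
      by (simp_all add: bform_euclid fz0 inner_vec_def sum_3 field_simps)
    then have "?x \<bullet> ?x = exp (2 * u 0)" "?y \<bullet> ?y = exp (2 * u 0)"
      using conf[OF D(3)] by simp_all
    then have "norm ?x = exp (u 0)" "norm ?y = exp (u 0)"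
      by (simp_all add: norm_eq_sqrt_inner real_sqrt_unique power2_eq_square flip: exp_add)
    then have sgn: "sgn ?x = exp (- u 0) *\<^sub>R ?x" "sgn ?y = exp (- u 0) *\<^sub>R ?y"
      by (simp_all add: sgn_div_norm exp_minus)
    show ?thesis
      by (simp add: vec_eq_iff forall_2 entry Y_def frame_row_def cmat2_def su2_of_def based_gauss_map_def
          sgn fz0 \<nu>_def inner_vec_def sum_3 field_simps)
  qed
  finally have "su2_of n = su2_of (based_gauss_map f N z)" .
  then show ?thesis
    by (auto simp: su2_of_def cmat2_def vec_eq_iff forall_2 forall_3 complex_eq_iff)
qed

section \<open>Lawson correspondents\<close>

theorem theorem6:
  fixes p H c :: real
    and D :: "complex set"
    and f_H N_H :: "complex \<Rightarrow> real^4"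
    and f_E N_E :: "complex \<Rightarrow> real^3"
    and u_H u_E :: "complex \<Rightarrow> real"
    and N_adj :: "complex \<Rightarrow> real^3"
  assumes "p > 1 / 2"
    and "open D" and "simply_connected D" and "0 \<in> D"
    and "cmc_H3 D f_H N_H u_H H" and "\<bar>H\<bar> > 1"
    and "cmc_E3 D f_E N_E u_E c"
    and "lawson_correspondents D f_E N_E u_E c f_H N_H u_H H"
    and "adjusted_gauss_map p D f_H N_H u_H H N_adj"
  shows "(\<forall>P. normalized_potential p D N_adj P \<longleftrightarrow>
              normalized_potential p D (based_gauss_map f_E N_E) P) \<and>
         (\<forall>P_H P_E. normalized_potential p D N_adj P_H \<longrightarrow>
                    normalized_potential p D (based_gauss_map f_E N_E) P_E \<longrightarrow>
                    (\<forall>z\<in>D. P_H z = P_E z))"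
proof -
  note D = \<open>open D\<close> simply_connected_imp_connected[OF \<open>simply_connected D\<close>] \<open>0 \<in> D\<close>
  have c: "c > 0" "\<bar>H\<bar> = sqrt (c\<^sup>2 + 1)"
    and same: "\<And>z. z \<in> D \<Longrightarrow> u_E z = u_H z"
      "\<And>z. z \<in> D \<Longrightarrow> hopf euclid_sig f_E N_E z = hopf lorentz_sig f_H N_H z"
    using assms(8) unfolding lawson_correspondents_def by auto
  have "H\<^sup>2 = c\<^sup>2 + 1"
    using c(2) by (metis power2_abs real_sqrt_pow2 add_nonneg_nonneg zero_le_power2 zero_le_one)
  then have h: "sqrt (H\<^sup>2 - 1) = c"
    using c(1) by simp
  obtain F where adj: "adjusted_frame p D u_H (hopf lorentz_sig f_H N_H) H F"
    and proj: "\<And>z. z \<in> D \<Longrightarrow> projects_to (F z 1) (N_adj z)"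
    using assms(9) unfolding adjusted_gauss_map_def by blast
  have one: "1 \<in> unit_circle" by simp
  have F: "\<And>z. z \<in> D \<Longrightarrow> F z \<in> Loop_SU2 p" "smooth_on D (\<lambda>z. F z 1)" "F 0 1 = mat 1"
      "\<And>z. z \<in> D \<Longrightarrow> matrix_inv (F z 1) ** mat_z (\<lambda>w. F w 1) z = MC_z u_H (hopf lorentz_sig f_H N_H) c 1 z"
      "\<And>z. z \<in> D \<Longrightarrow> matrix_inv (F z 1) ** mat_zbar (\<lambda>w. F w 1) z = MC_zbar u_H (hopf lorentz_sig f_H N_H) c 1 z"
    using adj one unfolding adjusted_frame_def h by blast+
  have "N_adj z = based_gauss_map f_E N_E z" if z: "z \<in> D" for z
  proof (rule adjusted_gauss_map_eq_based_gauss_map[OF D assms(7) _ F(2,3) _ _ proj[OF z] z])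
    fix w assume w: "w \<in> D"
    show "det (F w 1) = 1"
      using F(1)[OF w] by (simp add: Loop_SU2_def Loop_SL2_def)
    have "frechet_derivative (\<lambda>v. complex_of_real (u_H v)) (at w) = frechet_derivative (\<lambda>v. of_real (u_E v)) (at w)"
      by (rule frechet_derivative_cong[OF D(1) w]) (simp add: same)
    then have "MC_z u_E (hopf euclid_sig f_E N_E) c 1 w = MC_z u_H (hopf lorentz_sig f_H N_H) c 1 w"
      "MC_zbar u_E (hopf euclid_sig f_E N_E) c 1 w = MC_zbar u_H (hopf lorentz_sig f_H N_H) c 1 w"
      using same[OF w] by (simp_all add: MC_z_def MC_zbar_def pd_z_def pd_zbar_def pd_x_def pd_y_def)
    then show "matrix_inv (F w 1) ** mat_z (\<lambda>w. F w 1) w = MC_z u_E (hopf euclid_sig f_E N_E) c 1 w"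
      "matrix_inv (F w 1) ** mat_zbar (\<lambda>w. F w 1) w = MC_zbar u_E (hopf euclid_sig f_E N_E) c 1 w"
      using F(4,5)[OF w] by simp_all
  qed
  then have iff: "normalized_potential p D N_adj P \<longleftrightarrow>
      normalized_potential p D (based_gauss_map f_E N_E) P" for P
    by (rule normalized_potential_cong[OF D(1)])
  then show ?thesis
    using normalized_potential_unique[OF D] by blast
qed

end
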